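(* Let $K$ be a field of characteristic $p>0$, let $k=\bigcap_{n\ge0}K^{p^n}$ be its perfection, and assume $K/k$ is a finitely generated field extension. Then the following three sets are in natural bijection: (1) power towers on $K$; (2) Jacobson sequences on $K$; (3) $K$-subalgebras of $\operatorname{Diff}_k(K)$ (subrings containing the multiplication operators by elements of $K$). Explicitly, the following maps are well defined and give mutually inverse bijections between (1) and (2), and between (1) and (3): - (1)$\to$(2): $(W_0,W_1,W_2,\ldots)\mapsto (T_{W_0/W_1},T_{W_1/W_2},T_{W_2/W_3},\ldots)$; - (2)$\to$(1): $(\mathcal F_1,\mathcal F_2,\ldots)\mapsto (K,\operatorname{Ann}(\mathcal F_1),\operatorname{Ann}(\mathcal F_2),\ldots)$; - (1)$\to$(3): $W_\bullet\mapsto \bigcup_{i\ge0}\operatorname{Diff}_{W_i}(K)$; - (3)$\to$(1): $\mathcal D\mapsto(\operatorname{const}(\mathcal D_0),\operatorname{const}(\mathcal D_1),\operatorname{const}(\mathcal D_2),\ldots)$, where $\mathcal D_n=\mathcal D\cap\operatorname{Diff}_{K^{p^n}}(K)$.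
   Context: $K^{p^n}=\{x^{p^n}:x\in K\}$; $A\cdot B$ is the composite of subfields. A power tower on $K$ is a sequence of subfields $W_0,W_1,\ldots$ of $K$ with $W_j=W_i\cdot K^{p^j}$ for all $0\le j\le i$. For a subring $L\subset R$, $\operatorname{Diff}_L(R)\subset\operatorname{End}_L(R)$ is the ring of Grothendieck differential operators: $F_{-1}=0$, $F_d=\{D\in\operatorname{End}_L(R):[D,f]\in F_{d-1}\ \forall f\in R\}$ ($f$ = multiplication by $f$), $\operatorname{Diff}_L(R)=\bigcup_d F_d$. For fields $A\supset B$, $T_{A/B}=\operatorname{Der}_B(A)$, the $B$-linear derivations $A\to A$. A $p$-Lie algebra on a field $L$ (of characteristic $p$) is an $L$-subspace of $T_{L/L^p}$ closed under the commutator $[D,E]=D\circ E-E\circ D$ and under $D\mapsto D^{\circ p}$. For a set $\mathcal F$ of derivations of $L$, $\operatorname{Ann}(\mathcal F)=\{x\in L: D(x)=0\ \forall D\in\mathcal F\}$. A Jacobson sequence on $K$ is a sequence $(\mathcal F_1,\mathcal F_2,\ldots)$ such that $\mathcal F_1$ is a $p$-Lie algebra on $K$, and for each $i\ge1$, $\mathcal F_{i+1}$ is a $p$-Lie algebra on $\operatorname{Ann}(\mathcal F_i)$ satisfying $\mathcal F_{i+1}\cap T_{\operatorname{Ann}(\mathcal F_i)/\operatorname{Ann}(\mathcal F_{i-1})^p}=0$, where $\operatorname{Ann}(\mathcal F_0):=K$. For a set $\mathcal D$ of operators on $K$, $\operatorname{const}(\mathcal D)=\{x\in K: D\circ x=x\circ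 D\ \forall D\in\mathcal D\}$. *)

theory Defs
  imports "HOL-Computational_Algebra.Primes"
begin

text \<open>The field K is the whole type 'a::field. Subfields are subsets of the type.\<close>

definition subfield :: "'a::field set \<Rightarrow> bool" where
  "subfield S \<longleftrightarrow> 0 \<in> S \<and> 1 \<in> S \<and> (\<forall>x\<in>S. \<forall>y\<in>S. x + y \<in> S \<and> x * y \<in> S)
     \<and> (\<forall>x\<in>S. - x \<in> S \<and> inverse x \<in> S)"

definition composite :: "'a::field set \<Rightarrow> 'a set \<Rightarrow> 'a set" where
  "composite A B = \<Inter> {S. subfield S \<and> A \<union> B \<subseteq> S}"

definition pow_set :: "nat \<Rightarrow> 'a::field set \<Rightarrow> 'a set" where
  "pow_set m L = (\<lambda>x. x ^ m) ` L"

definition frob_pow :: "nat \<Rightarrow> nat \<Rightarrow> 'a::field set" where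
  "frob_pow p n = pow_set (p ^ n) UNIV"

definition perfection :: "nat \<Rightarrow> 'a::field set" where
  "perfection p = (\<Inter>n. frob_pow p n)"

definition fin_gen_over :: "'a::field set \<Rightarrow> bool" where
  "fin_gen_over k \<longleftrightarrow> (\<exists>S. finite S \<and> composite k S = UNIV)"

definition power_tower :: "nat \<Rightarrow> (nat \<Rightarrow> 'a::field set) \<Rightarrow> bool" where
  "power_tower p W \<longleftrightarrow> (\<forall>i. subfield (W i)) \<and>
     (\<forall>i j. j \<le> i \<longrightarrow> W j = composite (W i) (frob_pow p j))"

text \<open>Derivations of a subfield A, B-linear (B a subfield of A), represented as
  functions 'a \<Rightarrow> 'a that map A into A and vanish outside A (extensional convention).\<close>
definition Der :: "'a::field set \<Rightarrow> 'a set \<Rightarrow> ('a \<Rightarrow> 'a) set" where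
  "Der A B = {D. (\<forall>x\<in>A. D x \<in> A) \<and> (\<forall>x. x \<notin> A \<longrightarrow> D x = 0)
      \<and> (\<forall>x\<in>A. \<forall>y\<in>A. D (x + y) = D x + D y)
      \<and> (\<forall>x\<in>A. \<forall>y\<in>A. D (x * y) = x * D y + y * D x)
      \<and> (\<forall>b\<in>B. \<forall>x\<in>A. D (b * x) = b * D x)}"

definition p_Lie :: "nat \<Rightarrow> 'a::field set \<Rightarrow> ('a \<Rightarrow> 'a) set \<Rightarrow> bool" where
  "p_Lie p L V \<longleftrightarrow> V \<subseteq> Der L (pow_set p L) \<and> (\<lambda>x. 0) \<in> V
     \<and> (\<forall>D\<in>V. \<forall>E\<in>V. (\<lambda>x. D x + E x) \<in> V)
     \<and> (\<forall>l\<in>L. \<forall>D\<in>V. (\<lambda>x. l * D x) \<in> V)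
     \<and> (\<forall>D\<in>V. \<forall>E\<in>V. (\<lambda>x. D (E x) - E (D x)) \<in> V)
     \<and> (\<forall>D\<in>V. (D ^^ p) \<in> V)"

text \<open>Successive annihilators: AnnSeq F 0 = K, AnnSeq F (Suc i) = Ann(F i) (inside AnnSeq F i).
  Here F i stands for the paper's F_(i+1).\<close>
fun AnnSeq :: "(nat \<Rightarrow> ('a::field \<Rightarrow> 'a) set) \<Rightarrow> nat \<Rightarrow> 'a set" where
  "AnnSeq F 0 = UNIV"
| "AnnSeq F (Suc i) = {x \<in> AnnSeq F i. \<forall>D\<in>F i. D x = 0}"

definition jacobson :: "nat \<Rightarrow> (nat \<Rightarrow> ('a::field \<Rightarrow> 'a) set) \<Rightarrow> bool" where
  "jacobson p F \<longleftrightarrow> p_Lie p UNIV (F 0) \<and>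
     (\<forall>i. p_Lie p (AnnSeq F (Suc i)) (F (Suc i)) \<and>
          F (Suc i) \<inter> Der (AnnSeq F (Suc i)) (pow_set p (AnnSeq F i)) = {\<lambda>x. 0})"

definition End_over :: "'a::field set \<Rightarrow> ('a \<Rightarrow> 'a) set" where
  "End_over L = {D. (\<forall>x y. D (x + y) = D x + D y) \<and> (\<forall>l\<in>L. \<forall>x. D (l * x) = l * D x)}"

text \<open>diffF L (Suc d) is the paper's F_d; diffF L 0 = F_(-1) = 0.\<close>
fun diffF :: "'a::field set \<Rightarrow> nat \<Rightarrow> ('a \<Rightarrow> 'a) set" where
  "diffF L 0 = {\<lambda>x. 0}"
| "diffF L (Suc d) = {D \<in> End_over L. \<forall>f. (\<lambda>x. D (f * x) - f * D x) \<in> diffF L d}"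

definition Diff :: "'a::field set \<Rightarrow> ('a \<Rightarrow> 'a) set" where
  "Diff L = (\<Union>d. diffF L d)"

definition K_subalg :: "'a::field set \<Rightarrow> ('a \<Rightarrow> 'a) set \<Rightarrow> bool" where
  "K_subalg k \<D> \<longleftrightarrow> \<D> \<subseteq> Diff k \<and> (\<forall>c. (\<lambda>x. c * x) \<in> \<D>)
     \<and> (\<forall>D\<in>\<D>. \<forall>E\<in>\<D>. (\<lambda>x. D x + E x) \<in> \<D> \<and> (\<lambda>x. - D x) \<in> \<D> \<and> (D \<circ> E) \<in> \<D>)"

definition const :: "('a::field \<Rightarrow> 'a) set \<Rightarrow> 'a set" where
  "const \<D> = {x. \<forall>D\<in>\<D>. \<forall>y. D (x * y) = x * D y}"

end

theory Submission
  imports Defs "HOL-Library.FuncSet"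
begin

text \<open>Finite generation makes K finite over each \<open>frob_pow p n\<close>, and commutators with
  \<open>f ^ (p ^ n)\<close> are \<open>p ^ n\<close>-fold commutators with \<open>f\<close>. Hence \<open>Diff L = End L\<close> whenever L contains some
  \<open>frob_pow p n\<close>, every differential operator over k is linear over some \<open>frob_pow p n\<close>, and power towers
  correspond to subalgebras by applying Jacobson--Bourbaki at each finite level.

  For Jacobson sequences, a p-Lie algebra on A that is determined by its values on finitely many
  elements has a commuting dual family \<open>E y\<close> with \<open>E y ^^ p = 0\<close> on a minimal such set Y; Taylor
  expansion along the \<open>E y\<close> shows that Y generates A over the annihilator C, whence the Lie algebra is
  all of \<open>Der A C\<close>. Along a Jacobson sequence the set Y can be taken inside \<open>frob_pow p i\<close>, which is the
  tower condition. Conversely, to find a derivation of A over B not killing x, pass to a subfield M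
  maximal without x; a first-order operator obtained by repeated commutators from an M-linear
  functional gives a nonzero derivation over M, and its kernel in \<open>M(y)\<close> is M when y maps to 1.\<close>

subsection \<open>Subfields and composites\<close>

text \<open>Closure under \<open>inverse\<close> need only be checked away from 0, because
  \<open>inverse 0 = 0\<close>.\<close>

lemma subfieldI:
  assumes "0 \<in> S" "1 \<in> S" "\<And>x y. x \<in> S \<Longrightarrow> y \<in> S \<Longrightarrow> x + y \<in> S"
    "\<And>x y. x \<in> S \<Longrightarrow> y \<in> S \<Longrightarrow> x * y \<in> S" "\<And>x. x \<in> S \<Longrightarrow> - x \<in> S"
    "\<And>x. x \<in> S \<Longrightarrow> x \<noteq> 0 \<Longrightarrow> inverse x \<in> S"
  shows "subfield S"
  unfolding subfield_def using assms by (metis inverse_zero)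

context
  fixes S :: "'a::field set"
  assumes S: "subfield S"
begin

lemma subfield_zero: "0 \<in> S"
  using S by (simp add: subfield_def)

lemma subfield_one: "1 \<in> S"
  using S by (simp add: subfield_def)

lemma subfield_add: "x \<in> S \<Longrightarrow> y \<in> S \<Longrightarrow> x + y \<in> S"
  using S by (simp add: subfield_def)

lemma subfield_mult: "x \<in> S \<Longrightarrow> y \<in> S \<Longrightarrow> x * y \<in> S"
  using S by (simp add: subfield_def)

lemma subfield_uminus: "x \<in> S \<Longrightarrow> - x \<in> S"
  using S by (simp add: subfield_def)

lemma subfield_inverse: "x \<in> S \<Longrightarrow> inverse x \<in> S"
  using S by (simp add: subfield_def)

lemma subfield_diff: "x \<in> S \<Longrightarrow> y \<in> S \<Longrightarrow> x - y \<in> S"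
  using subfield_add[of x "- y"] subfield_uminus[of y] by simp

lemma subfield_power: "x \<in> S \<Longrightarrow> x ^ n \<in> S"
  by (induction n) (auto intro: subfield_one subfield_mult)

lemma subfield_of_nat: "of_nat n \<in> S"
  by (induction n) (auto intro: subfield_zero subfield_one subfield_add)

lemmas subfield_intros = subfield_zero subfield_one subfield_add subfield_mult subfield_uminus
  subfield_inverse subfield_diff subfield_power subfield_of_nat

end

lemma subfield_UNIV: "subfield UNIV"
  by (simp add: subfield_def)

lemma subfield_Inter: "(\<And>S. S \<in> \<S> \<Longrightarrow> subfield S) \<Longrightarrow> subfield (\<Inter>\<S>)"
  by (auto simp: subfield_def)

text \<open>Prepares Zorn's lemma in \<open>exists_derivation\<close>. Members of a chain are
  comparable, so any two elements of the union already lie in one member.\<close>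

lemma subfield_Union_chain:
  assumes "subset.chain {S. subfield S \<and> P S} \<C>" "\<C> \<noteq> {}"
  shows "subfield (\<Union>\<C>)"
proof -
  have sf: "subfield S" if "S \<in> \<C>" for S
    using assms(1) that by (auto simp: subset_chain_def)
  have common: "\<exists>S\<in>\<C>. x \<in> S \<and> y \<in> S" if "x \<in> \<Union>\<C>" "y \<in> \<Union>\<C>" for x y
    using assms(1) that unfolding subset_chain_def by blast
  show ?thesis
  proof (rule subfieldI)
    show "0 \<in> \<Union>\<C>" "1 \<in> \<Union>\<C>"
      using sf assms(2) subfield_zero subfield_one by blast+
    show "x + y \<in> \<Union>\<C>" "x * y \<in> \<Union>\<C>" if "x \<in> \<Union>\<C>" "y \<in> \<Union>\<C>" for x y
      using common[OF that] sf subfield_add subfield_mult by blast+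
    show "- x \<in> \<Union>\<C>" "inverse x \<in> \<Union>\<C>" if "x \<in> \<Union>\<C>" for x
      using that sf subfield_uminus subfield_inverse by blast+
  qed
qed

lemma subfield_composite: "subfield (composite A B)"
  unfolding composite_def by (rule subfield_Inter) auto

lemma composite_upper1: "A \<subseteq> composite A B"
  by (auto simp: composite_def)

lemma composite_upper2: "B \<subseteq> composite A B"
  by (auto simp: composite_def)

lemma composite_least: "subfield S \<Longrightarrow> A \<subseteq> S \<Longrightarrow> B \<subseteq> S \<Longrightarrow> composite A B \<subseteq> S"
  by (auto simp: composite_def)

lemma composite_mono: "A \<subseteq> A' \<Longrightarrow> B \<subseteq> B' \<Longrightarrow> composite A B \<subseteq> composite A' B'"
  by (meson composite_least composite_upper1 composite_upper2 subfield_composite subset_trans)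

lemma composite_absorb: "subfield A \<Longrightarrow> B \<subseteq> A \<Longrightarrow> composite A B = A"
  by (auto simp: composite_def)

section \<open>Frobenius powers in characteristic p\<close>

locale char_p =
  fixes p :: nat and ty :: "'a::field itself"
  assumes prime_p: "prime p" and char_p: "of_nat p = (0::'a)"
begin

lemma CHAR_p: "CHAR('a) = p"
proof -
  have "CHAR('a) dvd p" using char_p of_nat_eq_0_iff_char_dvd by blast
  moreover have "CHAR('a) \<noteq> 1" by simp
  ultimately show ?thesis using prime_p prime_nat_iff by blast
qed

lemma p_gt_1: "1 < p"
  using prime_p by (rule prime_gt_1_nat)

lemma p_pos: "0 < p"
  using p_gt_1 by simp

lemma power_add_frob: "(x + y :: 'a) ^ (p ^ n) = x ^ (p ^ n) + y ^ (p ^ n)"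
  using freshmans_dream'[where 'a='a, of "p ^ n" n x y] prime_p by (simp add: CHAR_p)

lemma power_uminus_frob: "(- x :: 'a) ^ (p ^ n) = - (x ^ (p ^ n))"
proof -
  have "x ^ (p ^ n) + (- x) ^ (p ^ n) = 0"
    unfolding power_add_frob[symmetric] using p_pos by (simp add: power_0_left)
  then show ?thesis by (simp add: add_eq_0_iff)
qed

text \<open>These factorials are inverted in Taylor expansions along a derivation, which is why such
  expansions stay below order p.\<close>

lemma fact_nonzero: "n < p \<Longrightarrow> (of_nat (fact n) :: 'a) \<noteq> 0"
  using prime_dvd_fact_iff[OF prime_p, of n] by (simp del: of_nat_fact add: of_nat_eq_0_iff_char_dvd CHAR_p)

text \<open>With \<open>composite_least\<close> this lets a statement about the p^n-th powers of a
  composite be checked on its generators.\<close>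

lemma subfield_frob_vimage:
  assumes "subfield (S::'a set)"
  shows "subfield {x. x ^ (p ^ n) \<in> S}"
  by (rule subfieldI)
    (use assms p_pos in \<open>auto simp: power_0_left power_add_frob power_uminus_frob power_mult_distrib
       power_inverse intro: subfield_intros\<close>)

lemma subfield_frob_image:
  assumes S: "subfield (S::'a set)"
  shows "subfield (pow_set (p ^ n) S)"
  unfolding pow_set_def
proof (rule subfieldI)
  show "0 \<in> (\<lambda>x. x ^ p ^ n) ` S"
    by (rule image_eqI[of _ _ 0]) (use S p_pos in \<open>auto simp: power_0_left intro: subfield_intros\<close>)
  show "1 \<in> (\<lambda>x. x ^ p ^ n) ` S"
    by (rule image_eqI[of _ _ 1]) (use S in \<open>auto intro: subfield_intros\<close>)
  fix x assume "x \<in> (\<lambda>x. x ^ p ^ n) ` S"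
  then obtain a where a: "a \<in> S" "x = a ^ p ^ n" by auto
  show "- x \<in> (\<lambda>x. x ^ p ^ n) ` S"
    by (rule image_eqI[of _ _ "- a"]) (use a S in \<open>auto simp: power_uminus_frob intro: subfield_intros\<close>)
  show "inverse x \<in> (\<lambda>x. x ^ p ^ n) ` S"
    by (rule image_eqI[of _ _ "inverse a"]) (use a S in \<open>auto simp: power_inverse intro: subfield_intros\<close>)
  fix y assume "y \<in> (\<lambda>x. x ^ p ^ n) ` S"
  then obtain b where b: "b \<in> S" "y = b ^ p ^ n" by auto
  show "x + y \<in> (\<lambda>x. x ^ p ^ n) ` S"
    by (rule image_eqI[of _ _ "a + b"]) (use a b S in \<open>auto simp: power_add_frob intro: subfield_intros\<close>)
  show "x * y \<in> (\<lambda>x. x ^ p ^ n) ` S"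
    by (rule image_eqI[of _ _ "a * b"]) (use a b S in \<open>auto simp: power_mult_distrib intro: subfield_intros\<close>)
qed

lemma subfield_frob_pow: "subfield (frob_pow p n :: 'a set)"
  unfolding frob_pow_def by (rule subfield_frob_image[OF subfield_UNIV])

lemma frob_pow_0: "(frob_pow p 0 :: 'a set) = UNIV"
  by (auto simp: frob_pow_def pow_set_def)

lemma frob_pow_Suc: "(frob_pow p (Suc n) :: 'a set) = pow_set p (frob_pow p n)"
  by (simp add: frob_pow_def pow_set_def image_image power_mult[symmetric] mult.commute)

lemma power_in_frob_pow: "(x::'a) ^ (p ^ n) \<in> frob_pow p n"
  by (auto simp: frob_pow_def pow_set_def)

lemma frob_pow_antimono:
  assumes "m \<le> n"
  shows "(frob_pow p n :: 'a set) \<subseteq> frob_pow p m"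
  using assms
proof (induction rule: dec_induct)
  case (step n)
  have "(frob_pow p (Suc n) :: 'a set) \<subseteq> frob_pow p n"
    unfolding frob_pow_Suc using subfield_power[OF subfield_frob_pow] by (auto simp: pow_set_def)
  with step show ?case by blast
qed simp

lemma perfection_subset: "(perfection p :: 'a set) \<subseteq> frob_pow p n"
  by (auto simp: perfection_def)

text \<open>The elements whose p^n-th power lies in \<open>T\<close> form a subfield. It contains
  the perfection and \<open>S\<close>, hence all of K.\<close>

lemma frob_pow_subset_if_gen:
  assumes S: "composite (perfection p) S = (UNIV::'a set)"
    and T: "subfield T" "perfection p \<subseteq> T" "(\<lambda>x. x ^ (p ^ n)) ` S \<subseteq> T"
  shows "frob_pow p n \<subseteq> T"
proof -
  have "composite (perfection p) S \<subseteq> {x. x ^ (p ^ n) \<in> T}"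
    using T by (intro composite_least subfield_frob_vimage) (auto intro: subfield_power)
  then show ?thesis
    unfolding S by (auto simp: frob_pow_def pow_set_def)
qed

end

subsection \<open>Linear spans and functionals\<close>

definition lin_sub :: "'a::field set \<Rightarrow> 'a set \<Rightarrow> bool" where
  "lin_sub W V \<longleftrightarrow> 0 \<in> V \<and> (\<forall>x\<in>V. \<forall>y\<in>V. x + y \<in> V) \<and> (\<forall>w\<in>W. \<forall>x\<in>V. w * x \<in> V)"

text \<open>Defined as an intersection, so that a span is bounded by exhibiting one subspace
  containing the generators; explicit linear combinations are avoided.\<close>

definition lin_span :: "'a::field set \<Rightarrow> 'a set \<Rightarrow> 'a set" where
  "lin_span W B = \<Inter> {V. lin_sub W V \<and> B \<subseteq> V}"

lemma lin_span_least: "lin_sub W V \<Longrightarrow> B \<subseteq> V \<Longrightarrow> lin_span W B \<subseteq> V"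
  by (auto simp: lin_span_def)

lemma lin_span_superset: "B \<subseteq> lin_span W B"
  by (auto simp: lin_span_def)

lemma lin_sub_lin_span: "lin_sub W (lin_span W B)"
  by (auto simp: lin_span_def lin_sub_def)

lemma lin_span_mono: "W \<subseteq> W' \<Longrightarrow> B \<subseteq> B' \<Longrightarrow> lin_span W B \<subseteq> lin_span W' B'"
  by (rule lin_span_least) (use lin_sub_lin_span[of W' B'] lin_span_superset[of B' W'] in
      \<open>auto simp: lin_sub_def\<close>)

text \<open>The set is the sum of \<open>V\<close> and the line through \<open>v\<close>, written so
  that membership exposes the coefficient of \<open>v\<close>.\<close>

lemma lin_sub_decompose:
  assumes "subfield W" "lin_sub W V"
  shows "lin_sub W {x. \<exists>c\<in>W. x - c * v \<in> V}"
  unfolding lin_sub_def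
proof (intro conjI ballI)
  show "0 \<in> {x. \<exists>c\<in>W. x - c * v \<in> V}"
    using assms subfield_zero[OF assms(1)] by (auto simp: lin_sub_def intro!: bexI[of _ 0])
  fix x assume "x \<in> {x. \<exists>c\<in>W. x - c * v \<in> V}"
  then obtain c where c: "c \<in> W" "x - c * v \<in> V" by auto
  { fix y assume "y \<in> {x. \<exists>c\<in>W. x - c * v \<in> V}"
    then obtain e where e: "e \<in> W" "y - e * v \<in> V" by auto
    have "(x - c * v) + (y - e * v) \<in> V" using c e assms by (auto simp: lin_sub_def)
    moreover have "(x - c * v) + (y - e * v) = x + y - (c + e) * v" by (simp add: algebra_simps)
    ultimately show "x + y \<in> {x. \<exists>c\<in>W. x - c * v \<in> V}"
      using subfield_add[OF assms(1) c(1) e(1)] by auto }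
  { fix w assume w: "w \<in> W"
    then have "w * (x - c * v) \<in> V" using c assms by (auto simp: lin_sub_def)
    moreover have "w * (x - c * v) = w * x - (w * c) * v" by (simp add: algebra_simps)
    ultimately show "w * x \<in> {x. \<exists>c\<in>W. x - c * v \<in> V}"
      using subfield_mult[OF assms(1) w c(1)] by auto }
qed

lemma lin_span_insertD:
  assumes "subfield W" "x \<in> lin_span W (insert v B)"
  shows "\<exists>c\<in>W. x - c * v \<in> lin_span W B"
proof -
  have "lin_span W (insert v B) \<subseteq> {x. \<exists>c\<in>W. x - c * v \<in> lin_span W B}"
  proof (rule lin_span_least[OF lin_sub_decompose[OF assms(1) lin_sub_lin_span]])
    have "\<exists>c\<in>W. v - c * v \<in> lin_span W B"
      using lin_sub_lin_span[of W B] subfield_one[OF assms(1)]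
      by (auto simp: lin_sub_def intro!: bexI[of _ 1])
    moreover have "\<exists>c\<in>W. b - c * v \<in> lin_span W B" if "b \<in> B" for b
      using that lin_span_superset[of B W] subfield_zero[OF assms(1)]
      by (auto intro!: bexI[of _ 0])
    ultimately show "insert v B \<subseteq> {x. \<exists>c\<in>W. x - c * v \<in> lin_span W B}" by auto
  qed
  with assms(2) show ?thesis by auto
qed

lemma lin_span_insertI:
  assumes "c \<in> W" "x - c * v \<in> lin_span W B"
  shows "x \<in> lin_span W (insert v B)"
proof -
  have "x - c * v \<in> lin_span W (insert v B)" "v \<in> lin_span W (insert v B)"
    using assms lin_span_mono[of W W B "insert v B"] lin_span_superset[of "insert v B" W] by auto
  then have "c * v + (x - c * v) \<in> lin_span W (insert v B)"
    using lin_sub_lin_span[of W "insert v B"] assms(1) unfolding lin_sub_def by blast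
  then show ?thesis by simp
qed

text \<open>Take a \<open>W\<close>-subspace \<open>M\<close> maximal among those containing 1 but
  not \<open>x\<close>. Maximality makes K the direct sum of \<open>M\<close> and
  \<open>W x\<close>, and \<open>D\<close> is the coordinate along \<open>x\<close>.\<close>

lemma functional_exists:
  fixes W :: "'a::field set"
  assumes W: "subfield W" and x: "x \<notin> W"
  shows "\<exists>D\<in>End_over W. range D \<subseteq> W \<and> D 1 = 0 \<and> D x = 1"
proof -
  define \<A> where "\<A> = {V. lin_sub W V \<and> 1 \<in> V \<and> x \<notin> V}"
  have "\<exists>M\<in>\<A>. \<forall>X\<in>\<A>. M \<subseteq> X \<longrightarrow> X = M"
  proof (rule subset_Zorn_nonempty)
    have "W \<in> \<A>" using W x by (auto simp: \<A>_def lin_sub_def intro: subfield_intros)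
    then show "\<A> \<noteq> {}" by auto
    fix \<C> assume C: "\<C> \<noteq> {}" "subset.chain \<A> \<C>"
    have mem: "lin_sub W V" "1 \<in> V" "x \<notin> V" if "V \<in> \<C>" for V
      using C(2) that by (auto simp: subset_chain_def \<A>_def)
    have common: "\<exists>V\<in>\<C>. a \<in> V \<and> b \<in> V" if "a \<in> \<Union>\<C>" "b \<in> \<Union>\<C>" for a b
      using C(2) that unfolding subset_chain_def by blast
    have "lin_sub W (\<Union>\<C>)"
      unfolding lin_sub_def
    proof (intro conjI ballI)
      show "0 \<in> \<Union>\<C>" using C(1) mem(1) unfolding lin_sub_def by blast
      show "a + b \<in> \<Union>\<C>" if "a \<in> \<Union>\<C>" "b \<in> \<Union>\<C>" for a b
        using common[OF that] mem(1) unfolding lin_sub_def by blast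
      show "w * a \<in> \<Union>\<C>" if "w \<in> W" "a \<in> \<Union>\<C>" for w a
        using that mem(1) unfolding lin_sub_def by blast
    qed
    then show "\<Union>\<C> \<in> \<A>" using C(1) mem(2,3) by (auto simp: \<A>_def)
  qed
  then obtain M where M: "lin_sub W M" "1 \<in> M" "x \<notin> M"
    and max: "\<And>V. lin_sub W V \<Longrightarrow> x \<notin> V \<Longrightarrow> M \<subseteq> V \<Longrightarrow> V = M"
    unfolding \<A>_def by blast
  have M0: "0 \<in> M" and Madd: "\<And>a b. a \<in> M \<Longrightarrow> b \<in> M \<Longrightarrow> a + b \<in> M"
    and Mmult: "\<And>w a. w \<in> W \<Longrightarrow> a \<in> M \<Longrightarrow> w * a \<in> M"
    using M(1) by (auto simp: lin_sub_def)
  have Mdiff: "a - b \<in> M" if "a \<in> M" "b \<in> M" for a b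
    using Madd[OF that(1) Mmult[OF subfield_uminus[OF W subfield_one[OF W]] that(2)]] by simp
  have ex: "\<exists>w\<in>W. y - w * x \<in> M" for y
  proof (cases "y \<in> M")
    case True
    then show ?thesis by (intro bexI[of _ 0]) (simp_all add: subfield_zero[OF W])
  next
    case False
    \<comment> \<open>Adjoining \<open>y\<close> to \<open>M\<close> must capture \<open>x\<close>
      by maximality; solving that relation for \<open>y\<close> writes \<open>y\<close> modulo
      \<open>M\<close> as a multiple of \<open>x\<close>.\<close>
    define V where "V = {z. \<exists>c\<in>W. z - c * y \<in> M}"
    have "y \<in> V" using subfield_one[OF W] M0 by (auto simp: V_def intro!: bexI[of _ 1])
    moreover have "M \<subseteq> V" using subfield_zero[OF W] by (auto simp: V_def intro!: bexI[of _ 0])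
    moreover have "lin_sub W V" unfolding V_def by (rule lin_sub_decompose[OF W M(1)])
    ultimately have "x \<in> V" using max[of V] False by blast
    then obtain c where c: "c \<in> W" "x - c * y \<in> M" by (auto simp: V_def)
    with M(3) have c0: "c \<noteq> 0" by auto
    have "- inverse c * (x - c * y) \<in> M"
      using c W by (intro Mmult) (auto intro: subfield_intros)
    moreover have "- inverse c * (x - c * y) = y - inverse c * x"
      using c0 by (simp add: algebra_simps)
    ultimately show ?thesis using subfield_inverse[OF W c(1)] by auto
  qed
  have unique: "w = w'" if "w \<in> W" "w' \<in> W" "y - w * x \<in> M" "y - w' * x \<in> M" for y w w'
  proof (rule ccontr)
    assume "w \<noteq> w'"
    have "(y - w' * x) - (y - w * x) \<in> M" using Mdiff[OF that(4,3)] .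
    then have "inverse (w - w') * ((y - w' * x) - (y - w * x)) \<in> M"
      using that W by (intro Mmult) (auto intro: subfield_intros)
    moreover have "(y - w' * x) - (y - w * x) = (w - w') * x" by (simp add: algebra_simps)
    ultimately show False using M(3) \<open>w \<noteq> w'\<close> by (simp add: mult.assoc[symmetric])
  qed
  define D where "D y = (SOME w. w \<in> W \<and> y - w * x \<in> M)" for y
  have D: "D y \<in> W" "y - D y * x \<in> M" for y
    using someI_ex[of "\<lambda>w. w \<in> W \<and> y - w * x \<in> M"] ex[of y] unfolding D_def by blast+
  have Deq: "D y = w" if "w \<in> W" "y - w * x \<in> M" for y w
    using unique[OF D(1) that(1) D(2) that(2)] .
  have "D (y + z) = D y + D z" for y z
    by (rule Deq) (use Madd[OF D(2)[of y] D(2)[of z]] D(1) in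
        \<open>auto simp: algebra_simps intro: subfield_add[OF W]\<close>)
  moreover have "D (w * y) = w * D y" if "w \<in> W" for w y
    by (rule Deq) (use Mmult[OF that D(2)[of y]] D(1) that in
        \<open>auto simp: algebra_simps intro: subfield_mult[OF W]\<close>)
  moreover have "D 1 = 0" "D x = 1"
    by (rule Deq; use W M M0 in \<open>simp add: subfield_intros\<close>)+
  ultimately show ?thesis using D(1) by (intro bexI[of _ D]) (auto simp: End_over_def)
qed

text \<open>The relation \<open>s ^ q \<in> L\<close> reduces exponents modulo \<open>q\<close>, so
  the span of the bounded monomials is stable under multiplication by \<open>S\<close>. Its
  stabiliser in \<open>A\<close> is a field, hence contains the composite; applying it to 1 gives
  the claim.\<close>

lemma composite_subset_span:
  fixes L A S :: "'a::field set"
  assumes A: "subfield A" "L \<subseteq> A" "S \<subseteq> A" and L: "subfield L"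
    and fin: "finite S" and q: "q > 0" "\<And>z. z \<in> A \<Longrightarrow> z ^ q \<in> L"
  shows "composite L S \<subseteq> lin_span L ((\<lambda>e. \<Prod>s\<in>S. s ^ e s) ` {e. \<forall>s\<in>S. e s < q})"
    (is "_ \<subseteq> lin_span L ?B")
proof -
  let ?R = "lin_span L ?B"
  have R0: "0 \<in> ?R" and Radd: "\<And>a b. a \<in> ?R \<Longrightarrow> b \<in> ?R \<Longrightarrow> a + b \<in> ?R"
    and Rmult: "\<And>w a. w \<in> L \<Longrightarrow> a \<in> ?R \<Longrightarrow> w * a \<in> ?R"
    using lin_sub_lin_span[of L ?B] by (auto simp: lin_sub_def)
  have stable: "s * r \<in> ?R" if s: "s \<in> S" and r: "r \<in> ?R" for s r
  proof -
    have "?R \<subseteq> {r. s * r \<in> ?R}"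
    proof (rule lin_span_least)
      show "lin_sub L {r. s * r \<in> ?R}"
        using R0 Radd Rmult by (auto simp: lin_sub_def distrib_left mult.left_commute)
      show "?B \<subseteq> {r. s * r \<in> ?R}"
      proof clarify
        fix e :: "'a \<Rightarrow> nat" assume e: "\<forall>s\<in>S. e s < q"
        define e' where "e' = e(s := Suc (e s))"
        have upd: "(\<Prod>t\<in>S. t ^ (e(s := j)) t) = s ^ j * (\<Prod>t\<in>S - {s}. t ^ e t)" for j
          by (subst prod.remove[OF fin s]) (auto intro: prod.cong)
        have old: "(\<Prod>t\<in>S. t ^ e t) = s ^ e s * (\<Prod>t\<in>S - {s}. t ^ e t)"
          using upd[of "e s"] by simp
        show "s * (\<Prod>t\<in>S. t ^ e t) \<in> ?R"
        proof (cases "Suc (e s) < q")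
          case True
          have "s * (\<Prod>t\<in>S. t ^ e t) = (\<Prod>t\<in>S. t ^ (e(s := Suc (e s))) t)"
            unfolding old upd by simp
          also have "\<dots> \<in> ?B" by (rule imageI) (use e True in auto)
          finally show ?thesis using lin_span_superset[of ?B L] by blast
        next
          case False
          \<comment> \<open>The exponent of \<open>s\<close> is already \<open>q - 1\<close>:
            multiplying by \<open>s\<close> resets it to 0 and releases the scalar
            \<open>s ^ q\<close>.\<close>
          then have "q = Suc (e s)" using e s by (metis Suc_lessI)
          then have "s * (\<Prod>t\<in>S. t ^ e t) = s ^ q * (\<Prod>t\<in>S. t ^ (e(s := 0)) t)"
            unfolding old upd by simp
          moreover have "(\<Prod>t\<in>S. t ^ (e(s := 0)) t) \<in> ?B" by (rule imageI) (use e q in auto)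
          moreover have "s ^ q \<in> L" using s A q by auto
          ultimately show ?thesis using lin_span_superset[of ?B L] Rmult by auto
        qed
      qed
    qed
    with r show ?thesis by blast
  qed
  \<comment> \<open>The stabiliser of the span. Restricting it to \<open>A\<close> guarantees
    \<open>z ^ q \<in> L\<close>, which is what makes inverses available.\<close>
  define T where "T = {z\<in>A. \<forall>r\<in>?R. z * r \<in> ?R}"
  have T_power: "z ^ n \<in> T" if "z \<in> T" for z n
    using that A(1) by (induction n) (auto simp: T_def mult.assoc intro: subfield_intros)
  have "subfield T"
  proof (rule subfieldI)
    show "- z \<in> T" if "z \<in> T" for z
    proof -
      have "- 1 * (z * r) \<in> ?R" if "r \<in> ?R" for r
        by (rule Rmult) (use that \<open>z \<in> T\<close> subfield_uminus[OF L subfield_one[OF L]] in \<open>auto simp: T_def\<close>)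
      with that A(1) show ?thesis by (auto simp: T_def intro: subfield_intros)
    qed
    \<comment> \<open>the inverse of \<open>z\<close> is \<open>z ^ (q - 1)\<close> divided by the scalar \<open>z ^ q\<close>\<close>
    show "inverse z \<in> T" if z: "z \<in> T" "z \<noteq> 0" for z
    proof -
      have scaled: "inverse (z ^ q) * (z ^ (q - 1) * r) \<in> ?R" if "r \<in> ?R" for r
        by (rule Rmult) (use that z T_power[OF z(1), of "q - 1"] q L in
            \<open>auto simp: T_def intro: subfield_inverse\<close>)
      have inv: "inverse (z ^ q) * (z ^ (q - 1) * r) = inverse z * r" for r
        using z q(1) by (cases q) (auto simp: field_simps)
      have "inverse z * r \<in> ?R" if "r \<in> ?R" for r using scaled[OF that] unfolding inv .
      with z A(1) show ?thesis by (auto simp: T_def intro: subfield_inverse)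
    qed
  qed (use R0 Radd A(1) in \<open>auto simp: T_def distrib_right mult.assoc intro: subfield_intros\<close>)
  then have "composite L S \<subseteq> T"
    by (rule composite_least) (use A stable Rmult in \<open>auto simp: T_def\<close>)
  moreover have "1 \<in> ?B" using q(1) by (intro image_eqI[of _ _ "\<lambda>_. 0"]) auto
  then have "1 \<in> ?R" using lin_span_superset[of ?B L] by blast
  moreover have "z * 1 \<in> ?R" if "z \<in> T" for z
    using that \<open>1 \<in> ?R\<close> unfolding T_def by blast
  ultimately show ?thesis by (simp add: subset_iff)
qed

text \<open>The exponent functions are arbitrary outside \<open>S\<close>, so there may be
  infinitely many of them; restricting them to \<open>S\<close> leaves the monomials
  unchanged.\<close>

lemma finite_monomials: "finite S \<Longrightarrow> finite ((\<lambda>e. \<Prod>s\<in>S. s ^ e s) ` {e. \<forall>s\<in>S. e s < (q::nat)})"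
proof -
  assume fin: "finite S"
  have "(\<lambda>e. \<Prod>s\<in>S. s ^ e s) ` {e. \<forall>s\<in>S. e s < q} \<subseteq>
      (\<lambda>e. \<Prod>s\<in>S. s ^ e s) ` (PiE S (\<lambda>_. {..<q}))"
  proof clarify
    fix e :: "'a \<Rightarrow> nat" assume "\<forall>s\<in>S. e s < q"
    then show "(\<Prod>s\<in>S. s ^ e s) \<in> (\<lambda>e. \<Prod>s\<in>S. s ^ e s) ` (PiE S (\<lambda>_. {..<q}))"
      by (intro image_eqI[of _ _ "restrict e S"]) (auto intro: prod.cong)
  qed
  moreover have "finite (PiE S (\<lambda>_. {..<q}))" using fin by (intro finite_PiE) auto
  ultimately show ?thesis by (meson finite_imageI finite_subset)
qed

subsection \<open>Commutators with multiplication operators\<close>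

text \<open>The commutator of \<open>D\<close> with multiplication by \<open>f\<close>. Taking
  \<open>f\<close> first makes \<open>ad f\<close> an operator that can be iterated.\<close>

definition ad :: "'a::field \<Rightarrow> ('a \<Rightarrow> 'a) \<Rightarrow> 'a \<Rightarrow> 'a" where
  "ad f D = (\<lambda>x. D (f * x) - f * D x)"

text \<open>The order filtration separated from linearity and tested only against multipliers in
  \<open>A\<close>. The index is shifted by one, as in \<open>diffF\<close>: level 0 contains only
  the zero operator.\<close>

primrec ordd :: "'a::field set \<Rightarrow> nat \<Rightarrow> ('a \<Rightarrow> 'a) \<Rightarrow> bool" where
  "ordd A 0 D \<longleftrightarrow> D = (\<lambda>x. 0)"
| "ordd A (Suc d) D \<longleftrightarrow> (\<forall>f\<in>A. ordd A d (ad f D))"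

lemma End_over_add: "D \<in> End_over L \<Longrightarrow> D (x + y) = D x + D y"
  by (simp add: End_over_def)

lemma End_over_mult: "D \<in> End_over L \<Longrightarrow> l \<in> L \<Longrightarrow> D (l * x) = l * D x"
  by (simp add: End_over_def)

lemma End_over_zero: "D \<in> End_over L \<Longrightarrow> D 0 = 0"
  using End_over_add[of D L 0 0] by (simp only: add_0_left add_cancel_right_right)

lemma End_over_uminus: "D \<in> End_over L \<Longrightarrow> D (- x) = - D x"
  using End_over_add[of D L x "- x"] End_over_zero[of D L] by (simp add: add_eq_0_iff)

lemma End_over_diff: "D \<in> End_over L \<Longrightarrow> D (x - y) = D x - D y"
  using End_over_add[of D L x "- y"] End_over_uminus[of D L y] by simp

lemma End_over_antimono: "L \<subseteq> L' \<Longrightarrow> End_over L' \<subseteq> End_over L"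
  by (auto simp: End_over_def)

lemma ad_End_over: "D \<in> End_over L \<Longrightarrow> ad f D \<in> End_over L"
  by (auto simp: End_over_def ad_def algebra_simps)

lemma ad_commute: "ad f (ad g D) = ad g (ad f D)"
  by (auto simp: ad_def algebra_simps)

lemma ad_zero: "ad f (\<lambda>x. 0) = (\<lambda>x. 0)"
  by (auto simp: ad_def)

lemma ad_funpow_commute: "(ad f ^^ n) (ad g D) = ad g ((ad f ^^ n) D)"
  by (induction n) (simp_all add: ad_commute)

lemma ad_funpow_zero: "(ad f ^^ n) (\<lambda>x. 0) = (\<lambda>x. 0)"
  by (induction n) (simp_all add: ad_zero)

lemma ad_eq_zero_iff: "ad l D = (\<lambda>x. 0) \<longleftrightarrow> (\<forall>x. D (l * x) = l * D x)"
  by (auto simp: ad_def fun_eq_iff)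

lemma ordd_zero: "ordd A d (\<lambda>x. 0)"
  by (induction d) (simp_all add: ad_zero)

lemma ordd_add: "ordd A d D \<Longrightarrow> ordd A d E \<Longrightarrow> ordd A d (\<lambda>x. D x + E x)"
proof (induction d arbitrary: D E)
  case (Suc d)
  have "ad f (\<lambda>x. D x + E x) = (\<lambda>x. ad f D x + ad f E x)" for f
    by (auto simp: ad_def algebra_simps)
  with Suc show ?case by simp
qed simp

lemma ordd_lmult: "ordd A d D \<Longrightarrow> ordd A d (\<lambda>x. c * D x)"
proof (induction d arbitrary: D)
  case (Suc d)
  have "ad f (\<lambda>x. c * D x) = (\<lambda>x. c * ad f D x)" for f
    by (auto simp: ad_def algebra_simps)
  with Suc show ?case by simp
qed simp

lemma ordd_rmult: "ordd A d D \<Longrightarrow> ordd A d (\<lambda>x. D (c * x))"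
proof (induction d arbitrary: D)
  case (Suc d)
  have "ad f (\<lambda>x. D (c * x)) = (\<lambda>x. ad f D (c * x))" for f
    by (auto simp: ad_def algebra_simps)
  with Suc show ?case by simp
qed simp

text \<open>Reduces an order bound to generators. The product rule is
  \<open>[D, fg] = [D, f] g + f [D, g]\<close>, and \<open>[D, 1/f] = - (1/f) [D, f] (1/f)\<close>;
  composing with multiplications on either side preserves the order.\<close>

lemma subfield_ordd:
  assumes D: "D \<in> End_over L"
  shows "subfield {f. ordd A d (ad f D)}"
proof (rule subfieldI)
  have "ad 0 D = (\<lambda>x. 0)" "ad 1 D = (\<lambda>x. 0)"
    by (auto simp: ad_def End_over_zero[OF D])
  then show "0 \<in> {f. ordd A d (ad f D)}" "1 \<in> {f. ordd A d (ad f D)}"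
    by (simp_all add: ordd_zero)
  fix f assume f: "f \<in> {f. ordd A d (ad f D)}"
  have "ad (- f) D = (\<lambda>x. - 1 * ad f D x)"
    by (auto simp: ad_def End_over_uminus[OF D])
  then show "- f \<in> {f. ordd A d (ad f D)}"
    using f ordd_lmult[of A d "ad f D" "- 1"] by simp
  { assume "f \<noteq> 0"
    then have "ad (inverse f) D = (\<lambda>x. - inverse f * ad f D (inverse f * x))"
      by (auto simp: ad_def fun_eq_iff right_diff_distrib mult.assoc[symmetric])
    then show "inverse f \<in> {f. ordd A d (ad f D)}"
      using f ordd_lmult[OF ordd_rmult, of A d "ad f D" "- inverse f" "inverse f"] by simp }
  fix g assume g: "g \<in> {f. ordd A d (ad f D)}"
  have "ad (f + g) D = (\<lambda>x. ad f D x + ad g D x)"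
    by (auto simp: ad_def End_over_add[OF D] algebra_simps)
  then show "f + g \<in> {f. ordd A d (ad f D)}"
    using f g ordd_add by simp
  have "ad (f * g) D = (\<lambda>x. ad f D (g * x) + f * ad g D x)"
    by (auto simp: ad_def algebra_simps)
  then show "f * g \<in> {f. ordd A d (ad f D)}"
    using f g ordd_add[OF ordd_rmult ordd_lmult] by simp
qed

text \<open>Induction on the total exponent. By \<open>subfield_ordd\<close> only commutators with
  generators matter, and since all \<open>ad\<close> commute, passing to \<open>ad s D\<close>
  lowers the exponent at \<open>s\<close> by one and keeps the others.\<close>

lemma ordd_Suc_sum:
  assumes "D \<in> End_over L" "finite S" "\<And>s. s \<in> S \<Longrightarrow> (ad s ^^ m s) D = (\<lambda>x. 0)"
  shows "ordd (composite L S) (Suc (sum m S)) D"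
  using assms(1,3)
proof (induction "sum m S" arbitrary: m D rule: less_induct)
  case less
  have "composite L S \<subseteq> {f. ordd (composite L S) (sum m S) (ad f D)}"
  proof (rule composite_least[OF subfield_ordd[OF less.prems(1)]])
    have "ad l D = (\<lambda>x. 0)" if "l \<in> L" for l
      using that less.prems(1) by (auto simp: ad_eq_zero_iff End_over_mult)
    then show "L \<subseteq> {f. ordd (composite L S) (sum m S) (ad f D)}"
      by (auto simp: ordd_zero)
    show "S \<subseteq> {f. ordd (composite L S) (sum m S) (ad f D)}"
    proof
      fix s assume s: "s \<in> S"
      show "s \<in> {f. ordd (composite L S) (sum m S) (ad f D)}"
      proof (cases "m s")
        case 0
        with less.prems(2)[OF s] have "D = (\<lambda>x. 0)" by simp
        then show ?thesis by (simp add: ad_zero ordd_zero)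
      next
        case (Suc j)
        let ?m = "m(s := j)"
        have "sum ?m (S - {s}) = sum m (S - {s})" by (rule sum.cong) auto
        then have sum: "sum m S = Suc (sum ?m S)"
          using sum.remove[OF assms(2) s, of m] sum.remove[OF assms(2) s, of ?m] Suc
          by simp
        have "(ad t ^^ ?m t) (ad s D) = (\<lambda>x. 0)" if "t \<in> S" for t
        proof (cases "t = s")
          case True
          then show ?thesis using less.prems(2)[OF s] Suc by (simp add: ad_funpow_commute)
        next
          case False
          then show ?thesis using less.prems(2)[OF that] by (simp add: ad_funpow_commute ad_zero)
        qed
        then have "ordd (composite L S) (Suc (sum ?m S)) (ad s D)"
          using sum less.prems(1) by (intro less.hyps) (auto intro: ad_End_over)
        with sum show ?thesis by simp
      qed
    qed
  qed
  then show ?case by auto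
qed

text \<open>Commutators inherit linearity, so the recursive linearity condition in
  \<open>diffF\<close> collapses to a single one.\<close>

lemma diffF_eq: "diffF L d = {D \<in> End_over L. ordd UNIV d D}"
proof (induction d)
  case 0
  then show ?case by (auto simp: End_over_def)
next
  case (Suc d)
  show ?case
    unfolding diffF.simps Suc.IH ad_def[symmetric] using ad_End_over[of _ L] by auto
qed

lemma Diff_subset_End_over: "Diff L \<subseteq> End_over L"
  by (auto simp: Diff_def diffF_eq)

lemma Diff_antimono: "L \<subseteq> L' \<Longrightarrow> Diff L' \<subseteq> Diff L"
  using End_over_antimono[of L L'] by (auto simp: Diff_def diffF_eq)

lemma ordd_ad_funpow:
  assumes "ordd A d D" "f \<in> A" "d \<le> n"
  shows "(ad f ^^ n) D = (\<lambda>x. 0)"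
  using assms
proof (induction d arbitrary: n D)
  case 0
  then show ?case by (simp add: ad_funpow_zero)
next
  case (Suc d)
  then obtain n' where n: "n = Suc n'" "d \<le> n'" by (cases n) auto
  have "(ad f ^^ n) D = (ad f ^^ n') (ad f D)"
    unfolding n by (simp add: ad_funpow_commute)
  with Suc n show ?case by simp
qed

text \<open>Precomposition and postcomposition with multiplication by \<open>f\<close> commute, and
  \<open>ad f\<close> is their difference, so this is a binomial expansion; the induction uses
  Pascal's rule.\<close>

lemma ad_funpow_expand:
  "(ad f ^^ n) D x = (\<Sum>j\<le>n. of_nat (n choose j) * (- f) ^ (n - j) * D (f ^ j * x))"
proof (induction n arbitrary: D)
  case (Suc n)
  have "(ad f ^^ Suc n) D x = (ad f ^^ n) (ad f D) x"
    by (simp add: ad_funpow_commute)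
  also have "\<dots> = (\<Sum>j\<le>n. of_nat (n choose j) * (- f) ^ (n - j) * D (f ^ Suc j * x))
      + (\<Sum>j\<le>n. of_nat (n choose j) * (- f) ^ (Suc n - j) * D (f ^ j * x))"
    unfolding Suc.IH sum.distrib[symmetric]
    by (rule sum.cong) (simp_all add: ad_def right_diff_distrib Suc_diff_le mult_ac)
  also have "\<dots> = (\<Sum>j\<le>Suc n. of_nat (Suc n choose j) * (- f) ^ (Suc n - j) * D (f ^ j * x))"
  proof -
    have "(\<Sum>j\<le>n. of_nat (n choose j) * (- f) ^ (Suc n - j) * D (f ^ j * x))
      = (\<Sum>j\<le>Suc n. of_nat (n choose j) * (- f) ^ (Suc n - j) * D (f ^ j * x))"
      by (simp add: binomial_eq_0)
    also have "\<dots> = (- f) ^ Suc n * D x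
      + (\<Sum>j\<le>n. of_nat (n choose Suc j) * (- f) ^ (n - j) * D (f ^ Suc j * x))"
      by (subst sum.atMost_Suc_shift) simp
    finally show ?thesis
      by (subst sum.atMost_Suc_shift) (simp add: sum.distrib algebra_simps)
  qed
  finally show ?case .
qed (simp add: ad_def)

section \<open>Iterated commutators and differential operators in characteristic p\<close>

context char_p
begin

text \<open>In the binomial expansion all terms except j = 0 and j = p have a coefficient divisible
  by p.\<close>

lemma ad_funpow_p: "ad (f::'a) ^^ p = ad (f ^ p)"
proof (intro ext)
  fix D :: "'a \<Rightarrow> 'a" and x
  have "(ad f ^^ p) D x = (\<Sum>j\<le>p. of_nat (p choose j) * (- f) ^ (p - j) * D (f ^ j * x))"
    by (rule ad_funpow_expand)
  also have "\<dots> = (\<Sum>j\<in>{0, p}. of_nat (p choose j) * (- f) ^ (p - j) * D (f ^ j * x))"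
  proof (intro sum.mono_neutral_right ballI)
    fix j assume "j \<in> {..p} - {0, p}"
    then have "p dvd (p choose j)"
      using prime_p p_pos by (intro dvd_choose_prime) auto
    then have "of_nat (p choose j) = (0::'a)"
      by (simp add: of_nat_eq_0_iff_char_dvd CHAR_p)
    then show "of_nat (p choose j) * (- f) ^ (p - j) * D (f ^ j * x) = 0" by simp
  qed auto
  \<comment> \<open>The sign comes from the Frobenius identity for negation, so p = 2 needs no
    separate treatment.\<close>
  also have "\<dots> = ad (f ^ p) D x"
    using p_pos power_uminus_frob[of f 1] by (simp add: ad_def)
  finally show "(ad f ^^ p) D x = ad (f ^ p) D x" .
qed

lemma ad_funpow_p_power: "ad (f::'a) ^^ (p ^ n) = ad (f ^ (p ^ n))"
proof (induction n arbitrary: f)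
  case (Suc n)
  have "ad f ^^ (p ^ Suc n) = (ad f ^^ p) ^^ (p ^ n)"
    by (simp add: funpow_mult)
  also have "\<dots> = ad ((f ^ p) ^ (p ^ n))"
    unfolding ad_funpow_p Suc.IH ..
  finally show ?case by (simp add: power_mult)
qed simp

text \<open>\<open>L\<close>-linearity kills the commutator with \<open>s ^ (p ^ n)\<close>, which
  is the p^n-fold commutator with \<open>s\<close>. Each generator thus has a finite exponent for
  \<open>ordd_Suc_sum\<close>.\<close>

lemma ordd_exists:
  assumes "D \<in> End_over L" "finite S" "\<And>s. s \<in> S \<Longrightarrow> (s::'a) ^ (p ^ n) \<in> L"
  shows "\<exists>d. ordd (composite L S) d D"
proof
  show "ordd (composite L S) (Suc (sum (\<lambda>_. p ^ n) S)) D"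
  proof (rule ordd_Suc_sum[OF assms(1,2)])
    fix s assume "s \<in> S"
    with assms show "(ad s ^^ (p ^ n)) D = (\<lambda>x. 0)"
      by (auto simp: ad_funpow_p_power ad_eq_zero_iff End_over_mult)
  qed
qed

lemma Diff_eq_End_over:
  assumes S: "finite S" "composite (perfection p) S = (UNIV::'a set)"
    and L: "frob_pow p n \<subseteq> (L::'a set)"
  shows "Diff L = End_over L"
proof
  have "perfection p \<subseteq> L" using order_trans[OF perfection_subset L] .
  then have "composite L S = UNIV"
    using composite_mono[of "perfection p" L S S] S(2) by auto
  moreover have "\<exists>d. ordd (composite L S) d D" if "D \<in> End_over L" for D
    using that S(1) by (rule ordd_exists) (use L power_in_frob_pow in blast)
  ultimately show "End_over L \<subseteq> Diff L"
    by (auto simp: Diff_def diffF_eq)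
qed (rule Diff_subset_End_over)

text \<open>An operator killed by \<open>d\<close> commutators is killed by p^d of them, since
  \<open>d < p ^ d\<close>; hence it commutes with every p^d-th power.\<close>

lemma Diff_subset_UN_End_over: "Diff k \<subseteq> (\<Union>n. End_over (frob_pow p n :: 'a set))"
proof
  fix D assume "D \<in> Diff k"
  then obtain d where D: "D \<in> End_over k" "ordd UNIV d D" by (auto simp: Diff_def diffF_eq)
  have "d < p ^ d" using p_gt_1 by (simp add: power_gt_expt)
  then have "ad (f ^ (p ^ d)) D = (\<lambda>x. 0)" for f
    using ordd_ad_funpow[OF D(2), of f "p ^ d"] by (simp add: ad_funpow_p_power)
  then have "D \<in> End_over (frob_pow p d)"
    using End_over_add[OF D(1)] by (auto simp: End_over_def frob_pow_def pow_set_def ad_eq_zero_iff)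
  then show "D \<in> (\<Union>n. End_over (frob_pow p n))" by blast
qed

end

subsection \<open>The Jacobson--Bourbaki correspondence\<close>

text \<open>The multipliers commuting with a fixed additive \<open>D\<close> form a subfield. This
  turns the tower identity into an intersection of operator rings.\<close>

lemma End_over_composite: "End_over (composite A B) = End_over A \<inter> End_over B"
proof
  show "End_over (composite A B) \<subseteq> End_over A \<inter> End_over B"
    using End_over_antimono composite_upper1 composite_upper2 by (metis Int_subset_iff)
  show "End_over A \<inter> End_over B \<subseteq> End_over (composite A B)"
  proof
    fix D assume D: "D \<in> End_over A \<inter> End_over B"
    then have "subfield {f. ordd A 0 (ad f D)}" by (intro subfield_ordd[of D A]) simp
    then have "composite A B \<subseteq> {f. ordd A 0 (ad f D)}"
      by (rule composite_least) (use D in \<open>auto simp: ad_eq_zero_iff End_over_mult\<close>)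
    then show "D \<in> End_over (composite A B)"
      using D by (auto simp: ad_eq_zero_iff End_over_def subset_iff)
  qed
qed

lemma subfield_const:
  assumes "\<D> \<subseteq> End_over L"
  shows "subfield (const \<D>)"
proof -
  have "const \<D> = \<Inter> ((\<lambda>D. {f. ordd L 0 (ad f D)}) ` \<D>)"
    by (auto simp: const_def ad_eq_zero_iff)
  moreover have "subfield {f. ordd L 0 (ad f D)}" if "D \<in> \<D>" for D
    using that assms by (intro subfield_ordd[of D L]) auto
  ultimately show ?thesis by (simp del: ordd.simps) (rule subfield_Inter, auto simp del: ordd.simps)
qed

lemma subset_const: "\<D> \<subseteq> End_over L \<Longrightarrow> L \<subseteq> const \<D>"
  by (auto simp: const_def End_over_def)

lemma subset_End_over_const: "\<D> \<subseteq> End_over L \<Longrightarrow> \<D> \<subseteq> End_over (const \<D>)"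
  by (auto simp: const_def End_over_def)

text \<open>A functional killing 1 but not \<open>x\<close> cannot commute with multiplication by
  \<open>x\<close>. Thus equality of two rings \<open>End_over\<close> can be pulled back to
  equality of the subfields.\<close>

lemma const_End_over:
  assumes "subfield W"
  shows "const (End_over W) = W"
proof
  show "const (End_over W) \<subseteq> W"
  proof
    fix x assume x: "x \<in> const (End_over W)"
    show "x \<in> W"
    proof (rule ccontr)
      assume "x \<notin> W"
      then obtain D where D: "D \<in> End_over W" "D 1 = 0" "D x = 1"
        using functional_exists[OF assms] by blast
      have "D (x * 1) = x * D 1" using x D(1) unfolding const_def by blast
      with D show False by simp
    qed
  qed
qed (rule subset_const[OF subset_refl])

context
  fixes \<D> :: "('a::field \<Rightarrow> 'a) set" and L :: "'a set"
  assumes linear: "\<D> \<subseteq> End_over L"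
    and scalar: "\<And>c. (\<lambda>x. c * x) \<in> \<D>"
    and add: "\<And>D E. D \<in> \<D> \<Longrightarrow> E \<in> \<D> \<Longrightarrow> (\<lambda>x. D x + E x) \<in> \<D>"
    and comp: "\<And>D E. D \<in> \<D> \<Longrightarrow> E \<in> \<D> \<Longrightarrow> D \<circ> E \<in> \<D>"
begin

lemma subalgebra_lmult: "D \<in> \<D> \<Longrightarrow> (\<lambda>x. c * D x) \<in> \<D>"
  using comp[OF scalar[of c]] by (simp add: comp_def)

text \<open>A double annihilator property, by induction on \<open>B\<close>. If \<open>D0\<close>
  kills \<open>B\<close> and sends \<open>v\<close> to 1, put \<open>c = D0 x\<close>: every
  operator killing \<open>B\<close> takes at \<open>x\<close> the value \<open>c\<close> times its
  value at \<open>v\<close>. Then \<open>c\<close> is a constant and \<open>x - c * v\<close>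
  satisfies the induction hypothesis.\<close>

lemma killed_in_span:
  assumes "finite B" "\<And>D. D \<in> \<D> \<Longrightarrow> (\<And>b. b \<in> B \<Longrightarrow> D b = 0) \<Longrightarrow> D x = 0"
  shows "x \<in> lin_span (const \<D>) B"
  using assms
proof (induction B arbitrary: x rule: finite_induct)
  case empty
  have "1 * x = 0" using empty scalar[of 1] by fast
  then show ?case using lin_sub_lin_span[of "const \<D>" "{}"] by (simp add: lin_sub_def)
next
  case (insert v B)
  show ?case
  proof (cases "\<exists>D\<in>\<D>. (\<forall>b\<in>B. D b = 0) \<and> D v \<noteq> 0")
    case False
    have "x \<in> lin_span (const \<D>) B"
      by (rule insert.IH, rule insert.prems) (use False in auto)
    then show ?thesis using lin_span_mono[of "const \<D>" "const \<D>" B "insert v B"] by auto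
  next
    case True
    then obtain D1 where D1: "D1 \<in> \<D>" "\<forall>b\<in>B. D1 b = 0" "D1 v \<noteq> 0" by auto
    define D0 where "D0 = (\<lambda>y. inverse (D1 v) * D1 y)"
    have D0: "D0 \<in> \<D>" "\<forall>b\<in>B. D0 b = 0" "D0 v = 1"
      using D1 subalgebra_lmult by (auto simp: D0_def)
    define c where "c = D0 x"
    have key: "D x = c * D v" if D: "D \<in> \<D>" "\<forall>b\<in>B. D b = 0" for D
    proof -
      have "(\<lambda>y. D y + (- D v) * D0 y) \<in> \<D>" by (rule add[OF D(1) subalgebra_lmult[OF D0(1)]])
      then have "D x + (- D v) * D0 x = 0"
        by (rule insert.prems) (use D D0 in auto)
      then show ?thesis by (simp add: c_def mult.commute)
    qed
    have c: "c \<in> const \<D>"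
      unfolding const_def
    proof clarify
      \<comment> \<open>The operator sending \<open>z\<close> to \<open>E (y * D0 z)\<close> also
        kills \<open>B\<close>; comparing its values at \<open>x\<close> and \<open>v\<close> yields
        the commutation of \<open>E\<close> with \<open>c\<close>.\<close>
      fix E y assume E: "E \<in> \<D>"
      have "E 0 = 0" using E linear End_over_zero by blast
      moreover have EyD0: "E \<circ> (\<lambda>z. y * D0 z) \<in> \<D>" by (rule comp[OF E subalgebra_lmult[OF D0(1)]])
      ultimately have "(E \<circ> (\<lambda>z. y * D0 z)) x = c * (E \<circ> (\<lambda>z. y * D0 z)) v"
        using D0 by (intro key[OF EyD0]) simp
      then show "E (c * y) = c * E y" using D0 by (simp add: c_def mult.commute)
    qed
    have "x - c * v \<in> lin_span (const \<D>) B"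
    proof (rule insert.IH)
      fix D assume D: "D \<in> \<D>" "\<And>b. b \<in> B \<Longrightarrow> D b = 0"
      have "D (x - c * v) = D x - D (c * v)" using D(1) linear End_over_diff by blast
      also have "D (c * v) = c * D v" using c D(1) by (auto simp: const_def)
      finally show "D (x - c * v) = 0" using key D by simp
    qed
    then show ?thesis by (rule lin_span_insertI[OF c])
  qed
qed

lemma lin_sub_equalizer:
  assumes "D \<in> End_over W" "E \<in> End_over W"
  shows "lin_sub W {x. D x = E x}"
  using End_over_zero[OF assms(1)] End_over_zero[OF assms(2)] assms
  by (auto simp: lin_sub_def End_over_def)

text \<open>Values are matched one point at a time. Either some operator killing \<open>B\<close>
  corrects the value at \<open>v\<close>, or \<open>v\<close> lies in the span of \<open>B\<close>
  over the constants and the value there is forced.\<close>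

lemma subalgebra_interpolation:
  assumes "finite B" "E \<in> End_over (const \<D>)"
  shows "\<exists>D\<in>\<D>. \<forall>b\<in>B. D b = E b"
  using assms(1)
proof (induction B rule: finite_induct)
  case empty
  then show ?case using scalar by auto
next
  case (insert v B)
  then obtain D where D: "D \<in> \<D>" "\<forall>b\<in>B. D b = E b" by auto
  show ?case
  proof (cases "\<exists>D'\<in>\<D>. (\<forall>b\<in>B. D' b = 0) \<and> D' v \<noteq> 0")
    case True
    then obtain D' where D': "D' \<in> \<D>" "\<forall>b\<in>B. D' b = 0" "D' v \<noteq> 0" by auto
    have "(\<lambda>y. D y + ((E v - D v) / D' v) * D' y) \<in> \<D>"
      by (rule add[OF D(1) subalgebra_lmult[OF D'(1)]])
    then show ?thesis by (rule rev_bexI) (use D D' in auto)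
  next
    case False
    then have "v \<in> lin_span (const \<D>) B" using killed_in_span[OF insert.hyps(1)] by blast
    moreover have "D \<in> End_over (const \<D>)" using D(1) subset_End_over_const[OF linear] by blast
    then have "lin_span (const \<D>) B \<subseteq> {x. D x = E x}"
      using D(2) assms(2) by (intro lin_span_least lin_sub_equalizer) auto
    ultimately show ?thesis using D by auto
  qed
qed

text \<open>Interpolating an endomorphism on a finite spanning set already identifies it with a
  member of the algebra, by linearity over the constants.\<close>

theorem Jacobson_Bourbaki:
  assumes "finite B" "lin_span L B = UNIV"
  shows "\<D> = End_over (const \<D>)"
proof
  show "End_over (const \<D>) \<subseteq> \<D>"
  proof
    fix E assume E: "E \<in> End_over (const \<D>)"
    then obtain D where D: "D \<in> \<D>" "\<forall>b\<in>B. D b = E b" using subalgebra_interpolation assms(1) by blast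
    have "D \<in> End_over (const \<D>)" using D(1) subset_End_over_const[OF linear] by blast
    then have "lin_span (const \<D>) B \<subseteq> {x. D x = E x}"
      using D(2) E by (intro lin_span_least lin_sub_equalizer) auto
    moreover have "lin_span L B \<subseteq> lin_span (const \<D>) B"
      by (rule lin_span_mono[OF subset_const[OF linear] subset_refl])
    ultimately have "D = E" using assms(2) by (auto simp: fun_eq_iff)
    with D show "E \<in> \<D>" by simp
  qed
qed (rule subset_End_over_const[OF linear])

end

subsection \<open>Power towers and subalgebras\<close>

locale fin_gen_char_p = char_p p ty for p and ty :: "'a::field itself" +
  fixes S :: "'a set"
  assumes finite_S: "finite S" and gen_S: "composite (perfection p) S = UNIV"
begin

lemma composite_gen:
  assumes "frob_pow p n \<subseteq> L"
  shows "composite L S = UNIV"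
proof -
  have "perfection p \<subseteq> L" using perfection_subset assms by blast
  then show ?thesis using composite_mono[of "perfection p" L S S] gen_S by auto
qed

lemma finite_span_frob_pow: "\<exists>B. finite B \<and> lin_span (frob_pow p n) B = (UNIV :: 'a set)"
proof (intro exI conjI)
  let ?B = "(\<lambda>e. \<Prod>s\<in>S. s ^ e s) ` {e. \<forall>s\<in>S. e s < p ^ n}"
  show "finite ?B" by (rule finite_monomials[OF finite_S])
  have "composite (frob_pow p n) S \<subseteq> lin_span (frob_pow p n) ?B"
    by (rule composite_subset_span[OF subfield_UNIV _ _ subfield_frob_pow finite_S])
      (use p_pos power_in_frob_pow in auto)
  then show "lin_span (frob_pow p n) ?B = UNIV" using composite_gen[of n] by auto
qed

lemma Diff_eq: "frob_pow p n \<subseteq> L \<Longrightarrow> Diff L = End_over (L :: 'a set)"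
  by (rule Diff_eq_End_over[OF finite_S gen_S])

lemma power_tower_subfield: "power_tower p W \<Longrightarrow> subfield (W i :: 'a set)"
  by (simp add: power_tower_def)

lemma power_tower_eq: "power_tower p W \<Longrightarrow> j \<le> i \<Longrightarrow> W j = composite (W i) (frob_pow p j :: 'a set)"
  unfolding power_tower_def by blast

lemma power_tower_antimono: "power_tower p W \<Longrightarrow> j \<le> i \<Longrightarrow> W i \<subseteq> (W j :: 'a set)"
  by (subst power_tower_eq[of W j i]) (simp_all add: composite_upper1)

lemma frob_pow_subset_power_tower: "power_tower p W \<Longrightarrow> frob_pow p i \<subseteq> (W i :: 'a set)"
  by (subst power_tower_eq[of W i i]) (simp_all add: composite_upper2)

text \<open>Each \<open>Diff (W i)\<close> is \<open>End_over (W i)\<close>, and these rings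
  increase with \<open>i\<close>. The tower identity says that cutting their union down to level
  \<open>n\<close> leaves exactly \<open>End_over (W n)\<close>.\<close>

lemma subalgebra_of_power_tower:
  assumes W: "power_tower p (W :: nat \<Rightarrow> 'a set)"
  shows "K_subalg (perfection p) (\<Union>i. Diff (W i))"
    and "const ((\<Union>i. Diff (W i)) \<inter> Diff (frob_pow p n)) = W n"
proof -
  have Diff_W: "Diff (W i) = End_over (W i)" for i
    by (rule Diff_eq[OF frob_pow_subset_power_tower[OF W]])
  have common: "\<exists>m. D \<in> End_over (W m) \<and> E \<in> End_over (W m)"
    if "D \<in> End_over (W i)" "E \<in> End_over (W j)" for D E i j
    using that End_over_antimono[OF power_tower_antimono[OF W]]
    by (intro exI[of _ "max i j"]) (meson max.cobounded1 max.cobounded2 subsetD)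
  show "K_subalg (perfection p) (\<Union>i. Diff (W i))"
    unfolding K_subalg_def
  proof (intro conjI allI ballI)
    have "perfection p \<subseteq> W i" for i
      using perfection_subset[of i] frob_pow_subset_power_tower[OF W, of i] by simp
    then show "(\<Union>i. Diff (W i)) \<subseteq> Diff (perfection p)" by (intro UN_least Diff_antimono)
    show "(\<lambda>x. c * x) \<in> (\<Union>i. Diff (W i))" for c
      by (auto simp: Diff_W End_over_def algebra_simps)
    fix D E assume "D \<in> (\<Union>i. Diff (W i))" "E \<in> (\<Union>i. Diff (W i))"
    then obtain i j where "D \<in> End_over (W i)" "E \<in> End_over (W j)" by (auto simp: Diff_W)
    then obtain m where DE: "D \<in> End_over (W m)" "E \<in> End_over (W m)" using common by blast
    have "(\<lambda>x. D x + E x) \<in> End_over (W m)" "(\<lambda>x. - D x) \<in> End_over (W m)"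
      "D \<circ> E \<in> End_over (W m)"
      using DE by (auto simp: End_over_def algebra_simps)
    then show "(\<lambda>x. D x + E x) \<in> (\<Union>i. Diff (W i))" "(\<lambda>x. - D x) \<in> (\<Union>i. Diff (W i))"
      "D \<circ> E \<in> (\<Union>i. Diff (W i))"
      by (auto simp: Diff_W)
  qed
  \<comment> \<open>Enlarging \<open>i\<close> to \<open>max i n\<close> makes the tower identity
    applicable to \<open>W n\<close>.\<close>
  have "End_over (W i) \<inter> End_over (frob_pow p n) \<subseteq> End_over (W n)" for i
  proof -
    have "End_over (W i) \<inter> End_over (frob_pow p n) \<subseteq>
        End_over (W (max i n)) \<inter> End_over (frob_pow p n)"
      using End_over_antimono[OF power_tower_antimono[OF W, of i "max i n"]] by auto
    also have "\<dots> = End_over (W n)"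
      using End_over_composite[of "W (max i n)" "frob_pow p n"]
        power_tower_eq[OF W, of n "max i n"] by simp
    finally show ?thesis .
  qed
  moreover have "End_over (W n) \<subseteq> End_over (frob_pow p n)"
    by (rule End_over_antimono[OF frob_pow_subset_power_tower[OF W]])
  ultimately have "(\<Union>i. Diff (W i)) \<inter> Diff (frob_pow p n) = End_over (W n)"
    unfolding Diff_W Diff_eq[OF subset_refl] by blast
  then show "const ((\<Union>i. Diff (W i)) \<inter> Diff (frob_pow p n)) = W n"
    by (simp add: const_End_over power_tower_subfield[OF W])
qed

text \<open>Jacobson--Bourbaki identifies the part of the algebra at level \<open>n\<close> with
  \<open>End_over (W n)\<close>. The tower identity follows by applying \<open>const\<close> to
  intersections of these parts, and the parts exhaust the algebra because each operator is linear
  over some \<open>frob_pow p n\<close>.\<close>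

lemma power_tower_of_subalgebra:
  fixes \<D> :: "('a \<Rightarrow> 'a) set"
  assumes \<D>: "K_subalg (perfection p) \<D>"
  shows "power_tower p (\<lambda>n. const (\<D> \<inter> Diff (frob_pow p n)))"
    and "(\<Union>i. Diff (const (\<D> \<inter> Diff (frob_pow p i)))) = \<D>"
proof -
  define W where "W n = const (\<D> \<inter> End_over (frob_pow p n))" for n
  have W_eq: "const (\<D> \<inter> Diff (frob_pow p n)) = W n" for n
    by (simp add: W_def Diff_eq[OF subset_refl])
  have sf: "subfield (W n)" for n
    unfolding W_def by (rule subfield_const[of _ "frob_pow p n"]) simp
  have frob_W: "frob_pow p n \<subseteq> W n" for n
    unfolding W_def by (rule subset_const) simp
  have JB: "\<D> \<inter> End_over (frob_pow p n) = End_over (W n)" for n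
  proof -
    obtain B :: "'a set" where B: "finite B" "lin_span (frob_pow p n) B = UNIV"
      using finite_span_frob_pow by blast
    show ?thesis
      unfolding W_def
    proof (rule Jacobson_Bourbaki[OF _ _ _ _ B])
      show "(\<lambda>x. c * x) \<in> \<D> \<inter> End_over (frob_pow p n)" for c
      proof
        show "(\<lambda>x. c * x) \<in> \<D>" using \<D> unfolding K_subalg_def by blast
        show "(\<lambda>x. c * x) \<in> End_over (frob_pow p n)"
          by (simp add: End_over_def distrib_left mult.left_commute)
      qed
      fix D E assume "D \<in> \<D> \<inter> End_over (frob_pow p n)" "E \<in> \<D> \<inter> End_over (frob_pow p n)"
      then have "D \<in> \<D>" "E \<in> \<D>" "D \<in> End_over (frob_pow p n)" "E \<in> End_over (frob_pow p n)"
        by auto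
      moreover from this have "(\<lambda>x. D x + E x) \<in> End_over (frob_pow p n)"
        "D \<circ> E \<in> End_over (frob_pow p n)"
        by (simp_all add: End_over_def algebra_simps)
      ultimately show "(\<lambda>x. D x + E x) \<in> \<D> \<inter> End_over (frob_pow p n)"
        "D \<circ> E \<in> \<D> \<inter> End_over (frob_pow p n)"
        using \<D> unfolding K_subalg_def by blast+
    qed simp
  qed
  have "W j = composite (W i) (frob_pow p j)" if "j \<le> i" for i j
  proof -
    have "End_over (frob_pow p j) \<subseteq> End_over (frob_pow p i :: 'a set)"
      by (rule End_over_antimono[OF frob_pow_antimono[OF that]])
    then have "End_over (W j) = End_over (W i) \<inter> End_over (frob_pow p j)"
      unfolding JB[symmetric] by auto
    then have "const (End_over (W j)) = const (End_over (composite (W i) (frob_pow p j)))"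
      by (simp add: End_over_composite)
    then show ?thesis by (simp add: const_End_over sf subfield_composite)
  qed
  with sf show "power_tower p (\<lambda>n. const (\<D> \<inter> Diff (frob_pow p n)))"
    unfolding W_eq power_tower_def by blast
  have "(\<Union>i. Diff (W i)) = (\<Union>i. \<D> \<inter> End_over (frob_pow p i))"
    by (simp add: JB Diff_eq[OF frob_W])
  also have "\<dots> = \<D> \<inter> (\<Union>i. End_over (frob_pow p i))" by simp
  also have "\<dots> = \<D>"
  proof (rule Int_absorb2)
    have "\<D> \<subseteq> Diff (perfection p)" using \<D> by (simp only: K_subalg_def)
    then show "\<D> \<subseteq> (\<Union>i. End_over (frob_pow p i))"
      using Diff_subset_UN_End_over by (rule order_trans)
  qed
  finally show "(\<Union>i. Diff (const (\<D> \<inter> Diff (frob_pow p i)))) = \<D>"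
    unfolding W_eq .
qed

end

subsection \<open>Derivations of subfields\<close>

lemma Der_mem: "D \<in> Der A B \<Longrightarrow> x \<in> A \<Longrightarrow> D x \<in> A"
  by (simp add: Der_def)

lemma Der_outside: "D \<in> Der A B \<Longrightarrow> x \<notin> A \<Longrightarrow> D x = 0"
  by (simp add: Der_def)

lemma Der_add: "D \<in> Der A B \<Longrightarrow> x \<in> A \<Longrightarrow> y \<in> A \<Longrightarrow> D (x + y) = D x + D y"
  by (simp add: Der_def)

lemma Der_mult: "D \<in> Der A B \<Longrightarrow> x \<in> A \<Longrightarrow> y \<in> A \<Longrightarrow> D (x * y) = x * D y + y * D x"
  by (simp add: Der_def)

lemma Der_antimono: "B \<subseteq> B' \<Longrightarrow> Der A B' \<subseteq> Der A B"
  unfolding Der_def by blast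

context
  fixes A :: "'a::field set"
  assumes A: "subfield A"
begin

lemma Der_zero: "D \<in> Der A B \<Longrightarrow> D 0 = 0"
  using Der_add[of D A B 0 0] subfield_zero[OF A] by (simp only: add_0_left add_cancel_right_right)

lemma Der_one: "D \<in> Der A B \<Longrightarrow> D 1 = 0"
  using Der_mult[of D A B 1 1] subfield_one[OF A]
  by (simp only: mult_1_left add_cancel_right_right)

lemma Der_uminus: "D \<in> Der A B \<Longrightarrow> x \<in> A \<Longrightarrow> D (- x) = - D x"
  using Der_add[of D A B x "- x"] Der_zero[of D B] subfield_uminus[OF A, of x]
  by (simp add: add_eq_0_iff)

lemma Der_diff: "D \<in> Der A B \<Longrightarrow> x \<in> A \<Longrightarrow> y \<in> A \<Longrightarrow> D (x - y) = D x - D y"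
  using Der_add[of D A B x "- y"] Der_uminus[of D B y] subfield_uminus[OF A, of y] by simp

text \<open>Linearity over \<open>B\<close> amounts to killing \<open>B\<close>, since
  \<open>D 1 = 0\<close>. \<open>Der A {}\<close> then serves as the set of all derivations of
  \<open>A\<close>.\<close>

lemma Der_iff:
  assumes "B \<subseteq> A"
  shows "D \<in> Der A B \<longleftrightarrow> D \<in> Der A {} \<and> (\<forall>b\<in>B. D b = 0)"
proof (intro iffI conjI ballI)
  assume D: "D \<in> Der A B"
  then show D0: "D \<in> Der A {}" using Der_antimono[of "{}" B A] by blast
  show "D b = 0" if "b \<in> B" for b
  proof -
    have "D (b * 1) = b * D 1"
      using D that subfield_one[OF A] unfolding Der_def by blast
    then show ?thesis using Der_one[OF D] by simp
  qed
next
  assume D: "D \<in> Der A {} \<and> (\<forall>b\<in>B. D b = 0)"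
  then have "D (b * x) = b * D x" if "b \<in> B" "x \<in> A" for b x
    using Der_mult[of D A "{}" b x] that assms by auto
  with D show "D \<in> Der A B" unfolding Der_def by blast
qed

lemma subfield_kernel:
  assumes D: "D \<in> Der A B"
  shows "subfield {a \<in> A. D a = 0}"
proof (rule subfieldI)
  show "inverse x \<in> {a \<in> A. D a = 0}" if x: "x \<in> {a \<in> A. D a = 0}" "x \<noteq> 0" for x
  proof -
    have "D (x * inverse x) = x * D (inverse x) + inverse x * D x"
      using x A by (intro Der_mult[OF D]) (auto intro: subfield_intros)
    then have "x * D (inverse x) = 0" using x Der_one[OF D] by simp
    then show ?thesis using x subfield_inverse[OF A] by auto
  qed
qed (use A Der_zero[OF D] Der_one[OF D] in
    \<open>auto simp: Der_add[OF D] Der_mult[OF D] Der_uminus[OF D] intro: subfield_intros\<close>)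

lemma Der_power: "D \<in> Der A B \<Longrightarrow> x \<in> A \<Longrightarrow> D (x ^ Suc n) = of_nat (Suc n) * x ^ n * D x"
proof (induction n)
  case (Suc n)
  have "D (x * x ^ Suc n) = x * D (x ^ Suc n) + x ^ Suc n * D x"
    by (rule Der_mult[OF Suc.prems]) (rule subfield_power[OF A Suc.prems(2)])
  also have "\<dots> = of_nat (Suc (Suc n)) * x ^ Suc n * D x"
    by (subst Suc.IH[OF Suc.prems]) (simp add: algebra_simps)
  finally show ?case by simp
qed simp

lemma Der_lincomb:
  assumes "D \<in> Der A B" "E \<in> Der A B" "l \<in> A"
  shows "(\<lambda>x. D x + E x) \<in> Der A B" "(\<lambda>x. l * D x) \<in> Der A B"
  using assms A unfolding Der_def
  by (auto simp: algebra_simps subfield_intros)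

lemma Der_commutator:
  assumes D: "D \<in> Der A {}" and E: "E \<in> Der A {}"
  shows "(\<lambda>x. D (E x) - E (D x)) \<in> Der A {}"
proof -
  note mem = Der_mem[OF D] Der_mem[OF E] subfield_add[OF A] subfield_mult[OF A]
  have "D (E (x * y)) - E (D (x * y)) = x * (D (E y) - E (D y)) + y * (D (E x) - E (D x))"
    if "x \<in> A" "y \<in> A" for x y
    using that by (simp add: mem Der_mult[OF D] Der_mult[OF E] Der_add[OF D] Der_add[OF E]) algebra
  moreover have "D (E (x + y)) - E (D (x + y)) = (D (E x) - E (D x)) + (D (E y) - E (D y))"
    if "x \<in> A" "y \<in> A" for x y
    using that by (simp add: mem Der_add[OF D] Der_add[OF E])
  moreover have "D (E x) - E (D x) = 0" if "x \<notin> A" for x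
    using that by (simp add: Der_outside[OF D] Der_outside[OF E] Der_zero[OF D] Der_zero[OF E])
  ultimately show ?thesis
    by (auto simp: Der_def subfield_diff[OF A] mem)
qed

lemma Der_funpow_mem: "D \<in> Der A B \<Longrightarrow> x \<in> A \<Longrightarrow> (D ^^ n) x \<in> A"
  by (induction n) (auto intro: Der_mem)

lemma Der_funpow_zero: "D \<in> Der A B \<Longrightarrow> (D ^^ n) 0 = 0"
  by (induction n) (auto simp: Der_zero)

lemma Der_funpow_add:
  "D \<in> Der A B \<Longrightarrow> x \<in> A \<Longrightarrow> y \<in> A \<Longrightarrow> (D ^^ n) (x + y) = (D ^^ n) x + (D ^^ n) y"
  by (induction n) (auto simp: Der_add Der_funpow_mem)

lemma Der_funpow_diff:
  "D \<in> Der A B \<Longrightarrow> x \<in> A \<Longrightarrow> y \<in> A \<Longrightarrow> (D ^^ n) (x - y) = (D ^^ n) x - (D ^^ n) y"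
  by (induction n) (auto simp: Der_diff Der_funpow_mem)

lemma Der_const_mult:
  assumes "D \<in> Der A B" "b \<in> A" "D b = 0" "x \<in> A"
  shows "D (b * x) = b * D x"
  using Der_mult[OF assms(1,2,4)] assms(3) by simp

lemma Der_funpow_const_mult:
  assumes "D \<in> Der A B" "b \<in> A" "D b = 0" "x \<in> A"
  shows "(D ^^ n) (b * x) = b * (D ^^ n) x"
  by (induction n) (simp_all add: Der_const_mult[OF assms(1-3)] Der_funpow_mem[OF assms(1,4)])

lemma Der_funpow_Leibniz:
  assumes D: "D \<in> Der A B" and xy: "x \<in> A" "y \<in> A"
  shows "(D ^^ n) (x * y) = (\<Sum>j\<le>n. of_nat (n choose j) * (D ^^ j) x * (D ^^ (n - j)) y)"
  using xy
proof (induction n arbitrary: x y)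
  case (Suc n)
  note mem = Der_mem[OF D] subfield_mult[OF A]
  have "(D ^^ Suc n) (x * y) = (D ^^ n) (x * D y) + (D ^^ n) (y * D x)"
    using Suc.prems by (simp add: funpow_Suc_right Der_mult[OF D] Der_funpow_add[OF D] mem del: funpow.simps)
  also have "(D ^^ n) (x * D y) = (\<Sum>j\<le>n. of_nat (n choose j) * (D ^^ j) x * (D ^^ (Suc n - j)) y)"
    using Suc.prems by (subst Suc.IH)
      (auto simp: mem Suc_diff_le funpow_Suc_right simp del: funpow.simps intro!: sum.cong)
  also have "\<dots> = (\<Sum>j\<le>Suc n. of_nat (n choose j) * (D ^^ j) x * (D ^^ (Suc n - j)) y)"
    by (simp add: binomial_eq_0)
  also have "\<dots> = x * (D ^^ Suc n) y
      + (\<Sum>j\<le>n. of_nat (n choose Suc j) * (D ^^ Suc j) x * (D ^^ (n - j)) y)"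
    by (subst sum.atMost_Suc_shift) simp
  also have "(D ^^ n) (y * D x) = (\<Sum>j\<le>n. of_nat (n choose j) * (D ^^ Suc j) x * (D ^^ (n - j)) y)"
    unfolding mult.commute[of y] using Suc.prems by (subst Suc.IH)
      (auto simp: mem funpow_Suc_right simp del: funpow.simps intro!: sum.cong)
  also have "x * (D ^^ Suc n) y
      + (\<Sum>j\<le>n. of_nat (n choose Suc j) * (D ^^ Suc j) x * (D ^^ (n - j)) y) +
      (\<Sum>j\<le>n. of_nat (n choose j) * (D ^^ Suc j) x * (D ^^ (n - j)) y)
    = (\<Sum>j\<le>Suc n. of_nat (Suc n choose j) * (D ^^ j) x * (D ^^ (Suc n - j)) y)"
    by (subst sum.atMost_Suc_shift)
      (simp add: sum.distrib distrib_right del: funpow.simps)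
  finally show ?case .
qed simp

text \<open>With \<open>D x = 1\<close> and \<open>D b = 0\<close>, the derivation acts on
  \<open>b * x ^ n\<close> like d/dx with constant \<open>b\<close>.\<close>

lemma Der_Taylor_coeff:
  assumes D: "D \<in> Der A B" and x: "x \<in> A" "D x = 1" and b: "b \<in> A" "D b = 0"
  shows "(D ^^ n) (b * x ^ n) = of_nat (fact n) * b"
proof (induction n)
  case (Suc n)
  have "D (b * x ^ Suc n) = of_nat (Suc n) * (b * x ^ n)"
    using Der_const_mult[OF D b subfield_power[OF A x(1)], of "Suc n"] Der_power[OF D x(1), of n] x(2)
    by (simp add: algebra_simps)
  then have "(D ^^ Suc n) (b * x ^ Suc n) = (D ^^ n) (of_nat (Suc n) * (b * x ^ n))"
    by (simp only: funpow_Suc_right comp_def)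
  also have "\<dots> = of_nat (Suc n) * (D ^^ n) (b * x ^ n)"
  proof (rule Der_funpow_const_mult[OF D])
    show "D (of_nat (Suc n)) = 0"
      using subfield_of_nat[OF subfield_kernel[OF D], of "Suc n"] by simp
  qed (use A x b in \<open>auto intro: subfield_intros\<close>)
  finally show ?case by (simp add: Suc.IH algebra_simps)
qed simp

lemma Der_Taylor_vanish:
  assumes D: "D \<in> Der A B" and x: "x \<in> A" "D x = 1" and b: "b \<in> A" "D b = 0" and mn: "m < n"
  shows "(D ^^ n) (b * x ^ m) = 0"
proof -
  have "n = (n - Suc m) + Suc m" using mn by simp
  then have "(D ^^ n) (b * x ^ m) = (D ^^ (n - Suc m)) (D ((D ^^ m) (b * x ^ m)))"
    by (metis funpow.simps(2) funpow_add comp_apply)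
  also have "D ((D ^^ m) (b * x ^ m)) = 0"
    unfolding Der_Taylor_coeff[OF D x b]
    using subfield_mult[OF subfield_kernel[OF D] subfield_of_nat[OF subfield_kernel[OF D]], of b] b
    by simp
  finally show ?thesis using Der_funpow_zero[OF D] by simp
qed

end

section \<open>Derivations in characteristic p\<close>

context char_p
begin

lemma Der_p_power:
  assumes "subfield A" "D \<in> Der A B" "x \<in> (A::'a set)"
  shows "D (x ^ p) = 0"
  using Der_power[OF assms, of "p - 1"] p_pos char_p by simp

text \<open>In the Leibniz formula of order p only the two extreme terms survive, which is the
  product rule.\<close>

lemma Der_funpow_p:
  assumes A: "subfield A" and D: "D \<in> Der (A::'a set) {}"
  shows "D ^^ p \<in> Der A {}"
proof -
  have "(D ^^ p) (x * y) = x * (D ^^ p) y + y * (D ^^ p) x" if xy: "x \<in> A" "y \<in> A" for x y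
  proof -
    have "(D ^^ p) (x * y) = (\<Sum>j\<le>p. of_nat (p choose j) * (D ^^ j) x * (D ^^ (p - j)) y)"
      by (rule Der_funpow_Leibniz[OF A D xy])
    also have "\<dots> = (\<Sum>j\<in>{0, p}. of_nat (p choose j) * (D ^^ j) x * (D ^^ (p - j)) y)"
    proof (intro sum.mono_neutral_right ballI)
      fix j assume "j \<in> {..p} - {0, p}"
      then have "p dvd (p choose j)"
        using prime_p p_pos by (intro dvd_choose_prime) auto
      then have "of_nat (p choose j) = (0::'a)"
        by (simp add: of_nat_eq_0_iff_char_dvd CHAR_p)
      then show "of_nat (p choose j) * (D ^^ j) x * (D ^^ (p - j)) y = 0" by simp
    qed auto
    also have "\<dots> = x * (D ^^ p) y + y * (D ^^ p) x" using p_pos by simp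
    finally show ?thesis .
  qed
  moreover have "(D ^^ p) x = 0" if "x \<notin> A" for x
  proof -
    \<comment> \<open>At least one application of \<open>D\<close> is required: the zeroth iterate
      is the identity and does not vanish outside \<open>A\<close>.\<close>
    obtain q where q: "p = Suc q" using p_pos by (cases p) auto
    show ?thesis
      using that by (simp add: q funpow_Suc_right Der_outside[OF D] Der_funpow_zero[OF A D]
          del: funpow.simps)
  qed
  ultimately show ?thesis
    using Der_funpow_add[OF A D] Der_funpow_mem[OF A D] by (simp add: Der_def)
qed

lemma p_Lie_Der:
  assumes A: "subfield A" and B: "B \<subseteq> (A::'a set)"
  shows "p_Lie p A (Der A B)"
proof -
  note iff = Der_iff[OF A B]
  show ?thesis
    unfolding p_Lie_def
  proof (intro conjI ballI subsetI)
    fix D assume D: "D \<in> Der A B"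
    then have D0: "D \<in> Der A {}" "\<And>b. b \<in> B \<Longrightarrow> D b = 0" by (simp_all add: iff)
    have "pow_set p A \<subseteq> A" using subfield_power[OF A] by (auto simp: pow_set_def)
    then show "D \<in> Der A (pow_set p A)"
      using D0(1) Der_p_power[OF A D] by (subst Der_iff[OF A]) (auto simp: pow_set_def)
    show "(\<lambda>x. l * D x) \<in> Der A B" if "l \<in> A" for l
      using Der_lincomb(2)[OF A D D that] .
    obtain q where q: "p = Suc q" using p_pos by (cases p) auto
    have "(D ^^ p) b = 0" if "b \<in> B" for b
      unfolding q funpow_Suc_right using D0(2)[OF that] Der_funpow_zero[OF A D] by simp
    then show "D ^^ p \<in> Der A B" using Der_funpow_p[OF A D0(1)] by (simp add: iff)
    fix E assume E: "E \<in> Der A B"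
    then have E0: "E \<in> Der A {}" "\<And>b. b \<in> B \<Longrightarrow> E b = 0" by (simp_all add: iff)
    show "(\<lambda>x. D x + E x) \<in> Der A B"
      using Der_lincomb(1)[OF A D E subfield_zero[OF A]] .
    show "(\<lambda>x. D (E x) - E (D x)) \<in> Der A B"
      using Der_commutator[OF A D0(1) E0(1)] D0 E0 by (simp add: iff Der_zero[OF A D] Der_zero[OF A E])
  next
    show "(\<lambda>x. 0) \<in> Der A B"
      using subfield_zero[OF A] by (simp add: Der_def)
  qed
qed

end

lemma p_LieD:
  assumes "p_Lie p A F"
  shows p_Lie_subset: "F \<subseteq> Der A (pow_set p A)"
    and p_Lie_zero: "(\<lambda>x. 0) \<in> F"
    and p_Lie_add: "\<forall>D\<in>F. \<forall>E\<in>F. (\<lambda>x. D x + E x) \<in> F"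
    and p_Lie_scale: "\<forall>l\<in>A. \<forall>D\<in>F. (\<lambda>x. l * D x) \<in> F"
    and p_Lie_bracket: "\<forall>D\<in>F. \<forall>E\<in>F. (\<lambda>x. D (E x) - E (D x)) \<in> F"
    and p_Lie_power: "\<forall>D\<in>F. D ^^ p \<in> F"
  using assms unfolding p_Lie_def by - (elim conjE; assumption)+

context char_p
begin

subsection \<open>The Jacobson correspondence in exponent one\<close>

text \<open>Choose a determining subset \<open>Y\<close> of least cardinality. Omitting
  \<open>y\<close> leaves a nonzero \<open>D\<close> in \<open>F\<close> killing the other points;
  it cannot kill \<open>y\<close>, so it can be rescaled to take the value 1 there.\<close>

lemma p_Lie_dual_family:
  assumes A: "subfield (A :: 'a set)" and F: "p_Lie p A F" and X: "finite X"
    and det: "\<forall>D\<in>F. (\<forall>x\<in>X. D x = 0) \<longrightarrow> D = (\<lambda>x. 0)"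
  shows "\<exists>Y\<subseteq>X. (\<forall>D\<in>F. (\<forall>x\<in>Y. D x = 0) \<longrightarrow> D = (\<lambda>x. 0)) \<and>
    (\<exists>E. (\<forall>y\<in>Y. E y \<in> F) \<and> (\<forall>y\<in>Y. \<forall>x\<in>Y. E y x = (if x = y then 1 else 0)))"
proof -
  define P where "P Y \<longleftrightarrow> Y \<subseteq> X \<and> (\<forall>D\<in>F. (\<forall>x\<in>Y. D x = 0) \<longrightarrow> D = (\<lambda>x. 0))" for Y
  have "P X" using det by (auto simp: P_def)
  then obtain Y where Y: "P Y" and min: "\<And>Z. P Z \<Longrightarrow> card Y \<le> card Z"
    using ex_has_least_nat[of P X card] by blast
  have sub: "Y \<subseteq> X" and Ydet: "\<And>D. D \<in> F \<Longrightarrow> \<forall>x\<in>Y. D x = 0 \<Longrightarrow> D = (\<lambda>x. 0)"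
    using Y by (auto simp: P_def)
  have ex: "\<exists>D\<in>F. \<forall>x\<in>Y. D x = (if x = y then 1 else 0)" if y: "y \<in> Y" for y
  proof -
    have "finite Y" using sub X by (rule finite_subset)
    then have "card (Y - {y}) < card Y" using y by (intro card_Diff1_less)
    then have "\<not> P (Y - {y})" using min[of "Y - {y}"] by linarith
    then obtain D where D: "D \<in> F" "\<forall>x\<in>Y - {y}. D x = 0" "D \<noteq> (\<lambda>x. 0)"
      using sub by (auto simp: P_def)
    have "D y \<noteq> 0" using Ydet[OF D(1)] D(2,3) by blast
    have "D \<in> Der A (pow_set p A)" using p_Lie_subset[OF F] D(1) by blast
    \<comment> \<open>\<open>X\<close> is not assumed to lie in \<open>A\<close>; outside
      \<open>A\<close> the extensional convention gives the value 0, which is in \<open>A\<close>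
      too.\<close>
    then have "D y \<in> A" using Der_mem Der_outside subfield_zero[OF A] by (cases "y \<in> A") fastforce+
    then have "(\<lambda>x. inverse (D y) * D x) \<in> F"
      by (intro p_Lie_scale[OF F, rule_format, OF _ D(1)] subfield_inverse[OF A])
    then show ?thesis using D(2) \<open>D y \<noteq> 0\<close> by (intro bexI[of _ "\<lambda>x. inverse (D y) * D x"]) auto
  qed
  define E where "E y = (SOME D. D \<in> F \<and> (\<forall>x\<in>Y. D x = (if x = y then 1 else 0)))" for y
  have E: "E y \<in> F \<and> (\<forall>x\<in>Y. E y x = (if x = y then 1 else 0))" if "y \<in> Y" for y
  proof -
    have "\<exists>D. D \<in> F \<and> (\<forall>x\<in>Y. D x = (if x = y then 1 else 0))" using ex[OF that] by blast
    from someI_ex[OF this] show ?thesis unfolding E_def .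
  qed
  show ?thesis
  proof (intro exI[of _ Y] exI[of _ E] conjI ballI impI)
    show "Y \<subseteq> X" by (rule sub)
    show "D = (\<lambda>x. 0)" if "D \<in> F" "\<forall>x\<in>Y. D x = 0" for D using Ydet[OF that] .
    show "E y \<in> F" if "y \<in> Y" for y using E[OF that] by blast
    show "E y x = (if x = y then 1 else 0)" if "y \<in> Y" "x \<in> Y" for y x using E[OF that(1)] that(2) by blast
  qed
qed

text \<open>Taylor expansion along \<open>D\<close>: subtracting the leading term
  \<open>c * x ^ n\<close> lowers the nilpotency order of \<open>a\<close>, and the coefficient lies
  in \<open>C\<close> because \<open>D\<close> kills it. The bound \<open>n \<le> p\<close> keeps
  the factorials invertible.\<close>

lemma nilpotent_derivation_generates:
  assumes A: "subfield (A :: 'a set)" and D: "D \<in> Der A B" and V: "subfield V" "V \<subseteq> A"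
    and DV: "\<And>a. a \<in> V \<Longrightarrow> D a \<in> V" and x: "x \<in> V" "D x = 1"
    and C: "subfield C" "\<And>b. b \<in> V \<Longrightarrow> D b = 0 \<Longrightarrow> b \<in> C" "x \<in> C"
    and n: "n \<le> p" and a: "a \<in> V" "(D ^^ n) a = 0"
  shows "a \<in> C"
  using n a
proof (induction n arbitrary: a)
  case 0
  then show ?case using subfield_zero[OF C(1)] by simp
next
  case (Suc n)
  have funpow_V: "(D ^^ m) a \<in> V" for m
    using Suc.prems(2) DV by (induction m) auto
  have ker: "subfield {a \<in> A. D a = 0}" by (rule subfield_kernel[OF A D])
  define c where "c = inverse (of_nat (fact n)) * (D ^^ n) a"
  have "(D ^^ n) a \<in> {a \<in> A. D a = 0}" using funpow_V V(2) Suc.prems(3) by auto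
  then have "c \<in> {a \<in> A. D a = 0}"
    unfolding c_def by (intro subfield_mult[OF ker] subfield_inverse[OF ker] subfield_of_nat[OF ker])
  moreover have cV: "c \<in> V"
    unfolding c_def using funpow_V
    by (intro subfield_mult[OF V(1)] subfield_inverse[OF V(1)] subfield_of_nat[OF V(1)])
  ultimately have c: "c \<in> A" "D c = 0" "c \<in> C" using C(2) by auto
  have fact: "(of_nat (fact n) :: 'a) \<noteq> 0" using Suc.prems by (intro fact_nonzero) simp
  have xn: "c * x ^ n \<in> V" using cV x by (intro subfield_mult[OF V(1)] subfield_power[OF V(1)])
  have "(D ^^ n) (a - c * x ^ n) = (D ^^ n) a - (D ^^ n) (c * x ^ n)"
    using Der_funpow_diff[OF A D, of a "c * x ^ n" n] Suc.prems(2) xn V(2) by blast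
  also have "(D ^^ n) (c * x ^ n) = of_nat (fact n) * c"
    using x V(2) by (intro Der_Taylor_coeff[OF A D _ _ c(1,2)]) auto
  also have "\<dots> = (D ^^ n) a" unfolding c_def mult.assoc[symmetric] using fact by (simp del: of_nat_fact)
  finally have "a - c * x ^ n \<in> C"
    using Suc.prems xn by (intro Suc.IH) (auto intro: subfield_diff[OF V(1)])
  then have "(a - c * x ^ n) + c * x ^ n \<in> C"
    using c(3) C(3) by (intro subfield_add[OF C(1)] subfield_mult[OF C(1)] subfield_power[OF C(1)])
  then show ?case by simp
qed

text \<open>Finiteness enters through the determining set \<open>X\<close>, which also generates
  \<open>A\<close> over the annihilator. Closure under brackets makes the dual family commute, and
  closure under p-th powers makes it nilpotent.\<close>

lemma Jacobson_exponent_one: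
  fixes A :: "'a set"
  assumes A: "subfield A" and F: "p_Lie p A F" and X: "finite X" "X \<subseteq> A"
    and det: "\<forall>D\<in>F. (\<forall>x\<in>X. D x = 0) \<longrightarrow> D = (\<lambda>x. 0)"
  defines "C \<equiv> {a \<in> A. \<forall>D\<in>F. D a = 0}"
  shows "subfield C" and "composite C X = A" and "Der A C = F"
proof -
  have F_Der: "D \<in> Der A {}" if "D \<in> F" for D
    using that p_Lie_subset[OF F] Der_antimono[of "{}" "pow_set p A" A] by auto
  have F_add: "(\<lambda>x. D x + E x) \<in> F" if "D \<in> F" "E \<in> F" for D E
    using p_Lie_add[OF F, rule_format, OF that] .
  have F_scale: "(\<lambda>x. l * D x) \<in> F" if "D \<in> F" "l \<in> A" for l D
    using p_Lie_scale[OF F, rule_format, OF that(2,1)] .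
  have F_bracket: "(\<lambda>x. D (E x) - E (D x)) \<in> F" if "D \<in> F" "E \<in> F" for D E
    using p_Lie_bracket[OF F, rule_format, OF that] .
  have F_power: "D ^^ p \<in> F" if "D \<in> F" for D
    using p_Lie_power[OF F, rule_format, OF that] .
  have F_zero: "(\<lambda>x. 0) \<in> F"
    using p_Lie_zero[OF F] .
  obtain Y E where YX: "Y \<subseteq> X"
    and YE: "\<forall>D\<in>F. (\<forall>x\<in>Y. D x = 0) \<longrightarrow> D = (\<lambda>x. 0)" "\<forall>y\<in>Y. E y \<in> F"
      "\<forall>y\<in>Y. \<forall>x\<in>Y. E y x = (if x = y then 1 else 0)"
    using p_Lie_dual_family[OF A F X(1) det] by (elim exE conjE)
  note Ydet = YE(1)[rule_format] and EF = YE(2)[rule_format] and dual = YE(3)[rule_format]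
  have YA: "Y \<subseteq> A" and finY: "finite Y" using YX X finite_subset by auto
  have ED: "E y \<in> Der A {}" if "y \<in> Y" for y using F_Der[OF EF[OF that]] .
  have E01: "E y 0 = 0" "E y 1 = 0" if "y \<in> Y" for y
    using Der_zero[OF A ED[OF that]] Der_one[OF A ED[OF that]] by auto
  \<comment> \<open>The bracket vanishes on \<open>Y\<close>, because the dual family takes only the
    values 0 and 1 there and derivations kill both.\<close>
  have commute: "E y (E z a) = E z (E y a)" if "y \<in> Y" "z \<in> Y" for y z a
  proof -
    have "(\<lambda>x. E y (E z x) - E z (E y x)) = (\<lambda>x. 0)"
    proof (rule Ydet[OF F_bracket[OF EF[OF that(1)] EF[OF that(2)]]])
      fix x assume "x \<in> Y"
      then show "E y (E z x) - E z (E y x) = 0"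
        by (simp add: dual[OF that(1)] dual[OF that(2)] E01[OF that(1)] E01[OF that(2)])
    qed
    then show ?thesis by (simp add: fun_eq_iff)
  qed
  have nilpotent: "E y ^^ p = (\<lambda>x. 0)" if y: "y \<in> Y" for y
  proof (rule Ydet[OF F_power[OF EF[OF y]]])
    fix x assume x: "x \<in> Y"
    \<comment> \<open>Two applications of \<open>E y\<close> already kill every point of
      \<open>Y\<close>, and p is at least 2.\<close>
    define q where "q = p - 2"
    have q: "p = Suc (Suc q)" using p_gt_1 by (simp add: q_def)
    have "E y (E y x) = 0" using dual[OF y x] E01[OF y] by simp
    then show "(E y ^^ p) x = 0"
      unfolding q funpow_Suc_right using Der_funpow_zero[OF A ED[OF y]] by simp
  qed
  \<comment> \<open>a derivation in \<open>F\<close> vanishing on the part of \<open>Y\<close> outside \<open>Z\<close> is a combination of \<open>E z\<close>, \<open>z \<in> Z\<close>\<close>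
  have span: "D a = 0"
    if "finite Z" "Z \<subseteq> Y" "D \<in> F" "\<And>x. x \<in> Y - Z \<Longrightarrow> D x = 0" "\<And>z. z \<in> Z \<Longrightarrow> E z a = 0" for Z D a
    using that
  proof (induction Z arbitrary: D rule: finite_induct)
    case empty
    then have "D = (\<lambda>x. 0)" by (intro Ydet) auto
    then show ?case by simp
  next
    case (insert z Z)
    have z: "z \<in> Y" using insert.prems by simp
    then have "D z \<in> A" using F_Der[OF insert.prems(2)] YA Der_mem by blast
    then have "(\<lambda>x. D x + (- D z) * E z x) \<in> F"
      using EF[OF z] insert.prems(2) by (intro F_add F_scale subfield_uminus[OF A])
    then have "D a + (- D z) * E z a = 0"
    proof (rule insert.IH[rotated])
      show "D x + (- D z) * E z x = 0" if "x \<in> Y - Z" for x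
        using that insert.prems(3)[of x] z by (cases "x = z") (auto simp: dual)
    qed (use insert.prems in auto)
    then show ?case using insert.prems(4)[of z] by simp
  qed
  show sfC: "subfield C"
  proof -
    have "C = \<Inter> (insert A ((\<lambda>D. {a \<in> A. D a = 0}) ` F))" by (auto simp: C_def)
    moreover have "subfield {a \<in> A. D a = 0}" if "D \<in> F" for D
      using subfield_kernel[OF A F_Der[OF that]] .
    ultimately show ?thesis by (simp only:) (rule subfield_Inter, use A in auto)
  qed
  have CA: "C \<subseteq> A" by (auto simp: C_def)
  \<comment> \<open>Elements of \<open>Y\<close> are released one at a time. If all
    \<open>E z\<close> kill \<open>a\<close>, then \<open>span\<close> puts \<open>a\<close> in
    \<open>C\<close>. Releasing \<open>x\<close>, the common kernel \<open>V\<close> of the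
    remaining \<open>E z\<close> is stable under \<open>E x\<close> by commutation, and elements of
    \<open>V\<close> killed by \<open>E x\<close> are covered by the induction hypothesis.\<close>
  have generated: "a \<in> composite C Z"
    if "finite Z" "Z \<subseteq> Y" "a \<in> A" "\<And>z. z \<in> Y - Z \<Longrightarrow> E z a = 0" for Z a
    using that
  proof (induction Z arbitrary: a rule: finite_induct)
    case empty
    then have "a \<in> C" using span[OF finY subset_refl] by (auto simp: C_def)
    then show ?case using composite_upper1 by blast
  next
    case (insert x Z)
    have x: "x \<in> Y" using insert.prems by simp
    define V where "V = {a \<in> A. \<forall>z\<in>Y - insert x Z. E z a = 0}"
    have "V = \<Inter> (insert A ((\<lambda>z. {a \<in> A. E z a = 0}) ` (Y - insert x Z)))"
      by (auto simp: V_def)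
    moreover have "subfield {a \<in> A. E z a = 0}" if "z \<in> Y" for z
      using subfield_kernel[OF A ED[OF that]] .
    ultimately have V: "subfield V" by (simp only:) (rule subfield_Inter, use A in auto)
    show ?case
    proof (rule nilpotent_derivation_generates[OF A ED[OF x] V, where x = x and n = p])
      show "E x b \<in> V" if "b \<in> V" for b
        using that x Der_mem[OF ED[OF x]] by (auto simp: V_def commute[OF _ x] E01)
      show "b \<in> composite C (insert x Z)" if b: "b \<in> V" "E x b = 0" for b
      proof -
        have "b \<in> composite C Z" by (rule insert.IH) (use b insert.prems in \<open>auto simp: V_def\<close>)
        then show ?thesis using composite_mono[of C C Z "insert x Z"] by auto
      qed
      show "(E x ^^ p) a = 0" using nilpotent[OF x] by simp
      show "x \<in> V" using x YA by (auto simp: V_def dual)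
      show "E x x = 1" using x by (simp add: dual)
      show "x \<in> composite C (insert x Z)" using composite_upper2 by blast
      show "a \<in> V" using insert.prems by (auto simp: V_def)
    qed (auto simp: V_def subfield_composite)
  qed
  have "A \<subseteq> composite C Y" using generated[OF finY subset_refl] by auto
  moreover have "composite C X \<subseteq> A" by (rule composite_least[OF A CA X(2)])
  moreover have "composite C Y \<subseteq> composite C X" using YX by (intro composite_mono) auto
  ultimately show "composite C X = A" by blast
  have AY: "A \<subseteq> composite C Y" by fact
  \<comment> \<open>Subtracting \<open>D z * E z\<close> for each \<open>z\<close> leaves a
    derivation over \<open>C\<close> that kills \<open>Y\<close>, hence kills
    \<open>composite C Y\<close>, which contains \<open>A\<close>.\<close>
  have in_F: "D \<in> F"
    if "finite Z" "Z \<subseteq> Y" "D \<in> Der A C" "\<And>x. x \<in> Y - Z \<Longrightarrow> D x = 0" for Z D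
    using that
  proof (induction Z arbitrary: D rule: finite_induct)
    case empty
    have "\<forall>c\<in>C. D c = 0" using empty Der_iff[OF A CA] by blast
    then have "composite C Y \<subseteq> {a \<in> A. D a = 0}"
      using empty CA YA by (intro composite_least subfield_kernel[OF A empty(2)]) auto
    then have "D = (\<lambda>x. 0)" using AY Der_outside[OF empty(2)] by (intro ext) blast
    then show ?case using F_zero by simp
  next
    case (insert z Z)
    have z: "z \<in> Y" using insert.prems by simp
    then have Dz: "D z \<in> A" using insert.prems(2) YA Der_mem by blast
    have EzC: "E z \<in> Der A C"
      using ED[OF z] EF[OF z] Der_iff[OF A CA, of "E z"] by (auto simp: C_def)
    have "(\<lambda>x. (- D z) * E z x) \<in> Der A C"
      by (rule Der_lincomb(2)[OF A EzC EzC subfield_uminus[OF A Dz]])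
    then have "(\<lambda>x. D x + (- D z) * E z x) \<in> Der A C"
      by (rule Der_lincomb(1)[OF A insert.prems(2) _ subfield_zero[OF A]])
    then have "(\<lambda>x. D x + (- D z) * E z x) \<in> F"
    proof (rule insert.IH[rotated])
      show "D x + (- D z) * E z x = 0" if "x \<in> Y - Z" for x
        using that insert.prems(3)[of x] z by (cases "x = z") (auto simp: dual)
    qed (use insert.prems in auto)
    then have "(\<lambda>x. (D x + (- D z) * E z x) + D z * E z x) \<in> F"
      by (rule F_add[OF _ F_scale[OF EF[OF z] Dz]])
    then show ?case by simp
  qed
  have "F \<subseteq> Der A C"
  proof
    fix D assume D: "D \<in> F"
    then have "\<forall>c\<in>C. D c = 0" by (simp add: C_def)
    then show "D \<in> Der A C" using F_Der[OF D] Der_iff[OF A CA] by blast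
  qed
  moreover have "Der A C \<subseteq> F" using in_F[OF finY subset_refl] by blast
  ultimately show "Der A C = F" by blast
qed

subsection \<open>Existence of derivations\<close>

text \<open>Keep taking commutators as long as some commutator satisfies \<open>P\<close>. The order
  drops each time and the zero operator fails \<open>P\<close>, so the process stops.\<close>

lemma exists_first_order_operator:
  fixes A :: "'a set" and P :: "('a \<Rightarrow> 'a) \<Rightarrow> bool"
  assumes "ordd A d D" "P D" "\<not> P (\<lambda>x. 0)"
  shows "\<exists>E. P E \<and> (\<forall>f\<in>A. \<not> P (ad f E))"
  using assms(1,2)
proof (induction d arbitrary: D)
  case 0
  with assms(3) show ?case by simp
next
  case (Suc d)
  show ?case
  proof (cases "\<exists>f\<in>A. P (ad f D)")
    case True
    then obtain f where f: "f \<in> A" "P (ad f D)" by blast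
    have "ordd A d (ad f D)" using Suc.prems(1) f(1) by simp
    then show ?thesis using Suc.IH f(2) by blast
  next
    case False
    with Suc.prems(2) show ?thesis by blast
  qed
qed

lemma exists_nonzero_derivation:
  fixes A M :: "'a set"
  assumes A: "subfield A" and M: "subfield M" "M \<subseteq> A" "M \<noteq> A" "pow_set p A \<subseteq> M"
    and X: "finite X" "composite M X = A"
  shows "\<exists>E\<in>Der A M. \<exists>y\<in>A. E y \<noteq> 0"
proof -
  \<comment> \<open>\<open>P\<close> selects \<open>M\<close>-linear operators preserving
    \<open>A\<close> that are not \<open>A\<close>-linear on \<open>A\<close>. Minimality for
    \<open>P\<close> forces every commutator with an element of \<open>A\<close> to be
    \<open>A\<close>-linear there, so the operator has order one on \<open>A\<close>.\<close>
  define P where "P D \<longleftrightarrow> D \<in> End_over M \<and> (\<forall>a\<in>A. D a \<in> A) \<and> (\<exists>a\<in>A. \<exists>b\<in>A. D (a * b) \<noteq> a * D b)" for D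
  obtain x where x: "x \<in> A" "x \<notin> M" using M by blast
  obtain D where D: "D \<in> End_over M" "range D \<subseteq> M" "D 1 = 0" "D x = 1"
    using functional_exists[OF M(1) x(2)] by blast
  have "D (x * 1) \<noteq> x * D 1" using D by simp
  then have PD: "P D"
    unfolding P_def using D M(2) x(1) subfield_one[OF A] by blast
  have "\<exists>d. ordd (composite M X) d D"
  proof (rule ordd_exists[OF D(1) X(1)])
    fix s assume "s \<in> X"
    then have "s \<in> A" using X(2) composite_upper2 by blast
    then show "s ^ (p ^ 1) \<in> M" using M(4) by (auto simp: pow_set_def)
  qed
  then obtain d where "ordd A d D" unfolding X(2) by blast
  moreover have "\<not> P (\<lambda>x. 0)" by (simp add: P_def)
  ultimately obtain D' where D': "P D'" "\<And>f. f \<in> A \<Longrightarrow> \<not> P (ad f D')"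
    using exists_first_order_operator[of A d D P] PD by blast
  have lin: "D' \<in> End_over M" and D'A: "\<And>a. a \<in> A \<Longrightarrow> D' a \<in> A" using D'(1) by (auto simp: P_def)
  have ad_A: "ad f D' a \<in> A" if "f \<in> A" "a \<in> A" for f a
    using that D'A unfolding ad_def by (intro subfield_diff[OF A] subfield_mult[OF A] D'A) auto
  have ad_lin: "ad f D' (a * b) = a * ad f D' b" if "f \<in> A" "a \<in> A" "b \<in> A" for f a b
    using D'(2)[OF that(1)] that ad_A ad_End_over[OF lin] unfolding P_def by blast
  \<comment> \<open>Removing multiplication by \<open>D' 1\<close> turns an operator of order one
    into a derivation; the value 0 outside \<open>A\<close> follows the convention of
    \<open>Der\<close>.\<close>
  define E where "E a = (if a \<in> A then D' a - a * D' 1 else 0)" for a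
  have E_mult: "E (a * b) = a * E b + b * E a" if ab: "a \<in> A" "b \<in> A" for a b
  proof -
    have "ad a D' (b * 1) = b * ad a D' 1"
      by (rule ad_lin[OF ab subfield_one[OF A]])
    then have "D' (a * b) = a * D' b + b * (D' a - a * D' 1)" by (simp add: ad_def algebra_simps)
    then show ?thesis using ab subfield_mult[OF A ab] by (simp add: E_def algebra_simps)
  qed
  have "E \<in> Der A {}"
    unfolding Der_def
  proof (intro CollectI conjI ballI allI impI)
    show "E a \<in> A" if "a \<in> A" for a
      using that D'A subfield_one[OF A]
      by (auto simp: E_def intro!: subfield_diff[OF A] subfield_mult[OF A])
    show "E (a + b) = E a + E b" if "a \<in> A" "b \<in> A" for a b
      using that subfield_add[OF A that] by (simp add: E_def End_over_add[OF lin] algebra_simps)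
    show "E (a * b) = a * E b + b * E a" if "a \<in> A" "b \<in> A" for a b
      by (rule E_mult[OF that])
  qed (auto simp: E_def)
  moreover have "E b = 0" if "b \<in> M" for b
    using End_over_mult[OF lin that, of 1] that M(2) by (auto simp: E_def)
  ultimately have "E \<in> Der A M" using Der_iff[OF A M(2)] by blast
  moreover have "\<exists>y\<in>A. E y \<noteq> 0"
  proof (rule ccontr)
    \<comment> \<open>If \<open>E\<close> vanished, \<open>D'\<close> would be multiplication by
      \<open>D' 1\<close> on \<open>A\<close>, contrary to the choice of \<open>P\<close>.\<close>
    assume "\<not> ?thesis"
    then have "\<And>y. y \<in> A \<Longrightarrow> D' y = y * D' 1" unfolding E_def by fastforce
    then have "D' (a * b) = a * D' b" if "a \<in> A" "b \<in> A" for a b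
      using that subfield_mult[OF A that] by (metis mult.assoc)
    then show False using D'(1) unfolding P_def by blast
  qed
  ultimately show ?thesis by blast
qed

text \<open>Peel off the top coefficient \<open>c\<close>. For positive degree n the n-th iterate of
  \<open>D\<close> kills \<open>a\<close> and all lower powers of \<open>y\<close>, but sends
  \<open>c * y ^ n\<close> to \<open>n!\<close> times \<open>c\<close>; hence
  \<open>c = 0\<close>.\<close>

lemma kernel_in_span_powers:
  assumes A: "subfield (A :: 'a set)" and M: "subfield M" "M \<subseteq> A" and D: "D \<in> Der A M"
    and y: "y \<in> A" "D y = 1" and n: "0 < n" "n \<le> p"
    and a: "a \<in> lin_span M ((\<lambda>j. y ^ j) ` {..<n})" "D a = 0"
  shows "a \<in> M"
  using n a
proof (induction n)
  case (Suc n)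
  have DM: "D b = 0" if "b \<in> M" for b using that D Der_iff[OF A M(2)] by blast
  have "{..<Suc n} = insert n {..<n}" by auto
  then have "a \<in> lin_span M (insert (y ^ n) ((\<lambda>j. y ^ j) ` {..<n}))" using Suc.prems(3) by simp
  then obtain c where c: "c \<in> M" "a - c * y ^ n \<in> lin_span M ((\<lambda>j. y ^ j) ` {..<n})"
    using lin_span_insertD[OF M(1)] by blast
  show ?case
  proof (cases "n = 0")
    case True
    \<comment> \<open>When only the zeroth power is left, \<open>a\<close> equals its coefficient
      and so lies in \<open>M\<close>.\<close>
    have "lin_span M {} \<subseteq> {0}" by (rule lin_span_least) (auto simp: lin_sub_def)
    then have "a = c" using c(2) True by auto
    with c(1) show ?thesis by simp
  next
    case False
    have cA: "c \<in> A" using c(1) M(2) by blast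
    have "lin_span M ((\<lambda>j. y ^ j) ` {..<n}) \<subseteq> {z \<in> A. (D ^^ n) z = 0}"
    proof (rule lin_span_least)
      have "(D ^^ n) (w * z) = 0" if "w \<in> M" "z \<in> A" "(D ^^ n) z = 0" for w z
        using Der_funpow_const_mult[OF A D _ DM[OF that(1)] that(2), of n] that M(2) by auto
      then show "lin_sub M {z \<in> A. (D ^^ n) z = 0}"
        using M(2) subfield_zero[OF A] subfield_add[OF A] subfield_mult[OF A]
        by (auto simp: lin_sub_def Der_funpow_zero[OF A D] Der_funpow_add[OF A D])
      have "(D ^^ n) (y ^ j) = 0" if "j < n" for j
        using Der_Taylor_vanish[OF A D y subfield_one[OF A] Der_one[OF A D] that] by simp
      then show "(\<lambda>j. y ^ j) ` {..<n} \<subseteq> {z \<in> A. (D ^^ n) z = 0}"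
        using subfield_power[OF A y(1)] by auto
    qed
    then have z: "a - c * y ^ n \<in> A" "(D ^^ n) (a - c * y ^ n) = 0" using c(2) by auto
    have cy: "c * y ^ n \<in> A" using cA y(1) by (intro subfield_mult[OF A] subfield_power[OF A])
    then have aA: "a \<in> A" using subfield_add[OF A z(1) cy] by simp
    obtain m where m: "n = Suc m" using False by (cases n) auto
    have "(D ^^ n) a = 0"
      unfolding m funpow_Suc_right using Suc.prems(4) Der_funpow_zero[OF A D] by simp
    then have "(D ^^ n) (c * y ^ n) = 0"
      using z(2) Der_funpow_diff[OF A D aA cy, of n] by simp
    then have "of_nat (fact n) * c = 0"
      using Der_Taylor_coeff[OF A D y cA DM[OF c(1)], of n] by simp
    then have "c = 0" using fact_nonzero[of n] Suc.prems(2) by (simp del: of_nat_fact)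
    then show ?thesis using Suc.IH False Suc.prems c(2) by simp
  qed
qed simp

text \<open>Derivations over \<open>B\<close> separate \<open>B\<close> from the rest of
  \<open>A\<close>, so a field in the tower is recovered as an annihilator.\<close>

lemma exists_derivation:
  fixes A B :: "'a set"
  assumes A: "subfield A" and B: "subfield B" "B \<subseteq> A" "pow_set p A \<subseteq> B"
    and X: "finite X" "composite B X = A" and x: "x \<in> A" "x \<notin> B"
  shows "\<exists>D\<in>Der A B. D x \<noteq> 0"
proof -
  define Q where "Q M \<longleftrightarrow> B \<subseteq> M \<and> M \<subseteq> A \<and> x \<notin> M" for M
  have "\<exists>M\<in>{M. subfield M \<and> Q M}. \<forall>N\<in>{M. subfield M \<and> Q M}. M \<subseteq> N \<longrightarrow> N = M"
  proof (rule subset_Zorn_nonempty)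
    have "B \<in> {M. subfield M \<and> Q M}" using B x by (simp add: Q_def)
    then show "{M. subfield M \<and> Q M} \<noteq> {}" by blast
    fix \<C> assume C: "\<C> \<noteq> {}" "subset.chain {M. subfield M \<and> Q M} \<C>"
    have "Q N" if "N \<in> \<C>" for N using that C(2) by (auto simp: subset_chain_def)
    then have "Q (\<Union>\<C>)" using C(1) unfolding Q_def by blast
    then show "\<Union>\<C> \<in> {M. subfield M \<and> Q M}" using subfield_Union_chain[OF C(2,1)] by simp
  qed
  then obtain M where M: "subfield M" "Q M" and max: "\<And>N. subfield N \<Longrightarrow> Q N \<Longrightarrow> M \<subseteq> N \<Longrightarrow> N = M"
    by blast
  have MA: "M \<subseteq> A" "B \<subseteq> M" "x \<notin> M" using M(2) by (auto simp: Q_def)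
  have "composite B X \<subseteq> composite M X" using MA by (intro composite_mono) auto
  moreover have "X \<subseteq> A" using X(2) composite_upper2 by blast
  then have "composite M X \<subseteq> A" using A MA by (intro composite_least) auto
  ultimately have "composite M X = A" using X(2) by blast
  then obtain E y where E: "E \<in> Der A M" and y: "y \<in> A" "E y \<noteq> 0"
    using exists_nonzero_derivation[OF A M(1) MA(1) _ _ X(1)] MA x B(3) by blast
  define D where "D = (\<lambda>z. inverse (E y) * E z)"
  have D: "D \<in> Der A M"
    unfolding D_def using Der_lincomb(2)[OF A E E subfield_inverse[OF A Der_mem[OF E y(1)]]] .
  have Dy: "D y = 1" using y(2) by (simp add: D_def)
  have "y \<notin> M" using E y(2) Der_iff[OF A MA(1)] by blast
  have yM: "composite M {y} \<subseteq> A" using A MA(1) y(1) by (intro composite_least) auto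
  \<comment> \<open>Adjoining \<open>y\<close> strictly enlarges \<open>M\<close>, since
    \<open>E\<close> kills \<open>M\<close> but not \<open>y\<close>; maximality then forces
    \<open>x\<close> into the larger field.\<close>
  have "x \<in> composite M {y}"
  proof (rule ccontr)
    assume "x \<notin> composite M {y}"
    then have "Q (composite M {y})"
      using yM MA(2) composite_upper1[of M "{y}"] by (auto simp: Q_def)
    then have "composite M {y} = M" using max subfield_composite composite_upper1 by blast
    then show False using composite_upper2[of "{y}" M] \<open>y \<notin> M\<close> by auto
  qed
  moreover have "composite M {y} \<subseteq> lin_span M ((\<lambda>e. \<Prod>s\<in>{y}. s ^ e s) ` {e. \<forall>s\<in>{y}. e s < p})"
    by (rule composite_subset_span[OF A MA(1) _ M(1)])
      (use y(1) p_pos B(3) MA(2) in \<open>auto simp: pow_set_def\<close>)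
  moreover have "(\<lambda>e. \<Prod>s\<in>{y}. s ^ e s) ` {e. \<forall>s\<in>{y}. e s < p} \<subseteq> (\<lambda>j. y ^ j) ` {..<p}"
    by auto
  ultimately have "x \<in> lin_span M ((\<lambda>j. y ^ j) ` {..<p})"
    using lin_span_mono[OF subset_refl] by blast
  then have "D x \<noteq> 0"
    using kernel_in_span_powers[OF A M(1) MA(1) D y(1) Dy p_pos order_refl] MA(3) by blast
  moreover have "D \<in> Der A B" using D Der_antimono[OF MA(2)] by blast
  ultimately show ?thesis by blast
qed

end

subsection \<open>Power towers and Jacobson sequences\<close>

context fin_gen_char_p
begin

text \<open>\<open>A'\<close> contains the perfection, and over the perfection the p^i-th powers of
  \<open>S\<close> generate \<open>frob_pow p i\<close>. This supplies the finite generating sets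
  required at each level.\<close>

lemma finite_generators:
  assumes A': "subfield (A' :: 'a set)" "frob_pow p (Suc i) \<subseteq> A'"
  shows "composite A' ((\<lambda>s. s ^ (p ^ i)) ` S) = composite A' (frob_pow p i)"
proof
  show "composite A' ((\<lambda>s. s ^ (p ^ i)) ` S) \<subseteq> composite A' (frob_pow p i)"
    using power_in_frob_pow by (intro composite_mono) auto
  have "perfection p \<subseteq> A'" using perfection_subset[of "Suc i"] A'(2) by simp
  then have "frob_pow p i \<subseteq> composite A' ((\<lambda>s. s ^ (p ^ i)) ` S)"
    using composite_upper1[of A'] composite_upper2[of _ A']
    by (intro frob_pow_subset_if_gen[OF gen_S subfield_composite]) auto
  then show "composite A' (frob_pow p i) \<subseteq> composite A' ((\<lambda>s. s ^ (p ^ i)) ` S)"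
    by (intro composite_least subfield_composite composite_upper1)
qed

lemma pow_set_composite_subset:
  assumes A': "subfield (A' :: 'a set)" "frob_pow p (Suc i) \<subseteq> A'"
  shows "pow_set p (composite A' (frob_pow p i)) \<subseteq> A'"
proof -
  have "composite A' (frob_pow p i) \<subseteq> {x. x ^ (p ^ 1) \<in> A'}"
  proof (rule composite_least[OF subfield_frob_vimage[OF A'(1)]])
    show "A' \<subseteq> {x. x ^ (p ^ 1) \<in> A'}" using subfield_power[OF A'(1)] by auto
    show "frob_pow p i \<subseteq> {x. x ^ (p ^ 1) \<in> A'}"
      using A'(2) unfolding frob_pow_Suc pow_set_def by auto
  qed
  then show ?thesis by (auto simp: pow_set_def)
qed

lemma Der_eq_zeroI:
  assumes A: "subfield (A :: 'a set)" and D: "D \<in> Der A B" and gen: "A \<subseteq> composite C C'"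
    and "\<And>x. x \<in> C \<union> C' \<Longrightarrow> x \<in> A \<and> D x = 0"
  shows "D = (\<lambda>x. 0)"
proof -
  have "composite C C' \<subseteq> {a \<in> A. D a = 0}"
    by (rule composite_least[OF subfield_kernel[OF A D]]) (use assms(4) in auto)
  then show ?thesis using gen Der_outside[OF D] by (intro ext) blast
qed

text \<open>Consecutive fields form an extension of exponent one with finitely many generators, so
  \<open>exists_derivation\<close> computes the annihilators. Induction on the level then identifies
  \<open>AnnSeq\<close> with \<open>W\<close>.\<close>

lemma jacobson_of_power_tower:
  assumes W: "power_tower p (W :: nat \<Rightarrow> 'a set)"
  shows "AnnSeq (\<lambda>i. Der (W i) (W (Suc i))) = W"
    and "jacobson p (\<lambda>i. Der (W i) (W (Suc i)))"
proof -
  note sf = power_tower_subfield[OF W]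
  have sub: "W (Suc i) \<subseteq> W i" for i by (rule power_tower_antimono[OF W]) simp
  have frob: "frob_pow p i \<subseteq> W i" for i by (rule frob_pow_subset_power_tower[OF W])
  have eq: "W i = composite (W (Suc i)) (frob_pow p i)" for i by (rule power_tower_eq[OF W]) simp
  have ann: "{x \<in> W i. \<forall>D\<in>Der (W i) (W (Suc i)). D x = 0} = W (Suc i)" (is "?L i = _") for i
  proof
    show "W (Suc i) \<subseteq> ?L i" using sub[of i] Der_iff[OF sf sub, of _ i] by blast
    show "?L i \<subseteq> W (Suc i)"
    proof (rule ccontr)
      assume "\<not> ?L i \<subseteq> W (Suc i)"
      then obtain x where x: "x \<in> ?L i" "x \<notin> W (Suc i)" by blast
      have "composite (W (Suc i)) ((\<lambda>s. s ^ (p ^ i)) ` S) = W i"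
        using finite_generators[OF sf frob] eq[of i] by simp
      moreover have "pow_set p (W i) \<subseteq> W (Suc i)"
        using pow_set_composite_subset[OF sf frob] eq[of i] by simp
      ultimately have "\<exists>D\<in>Der (W i) (W (Suc i)). D x \<noteq> 0"
        using x finite_S by (intro exists_derivation[OF sf sf sub]) auto
      with x show False by blast
    qed
  qed
  have W0: "W 0 = UNIV" using frob[of 0] by (auto simp: frob_pow_0)
  have AnnSeq_W: "AnnSeq (\<lambda>i. Der (W i) (W (Suc i))) n = W n" for n
    by (induction n) (simp_all only: AnnSeq.simps W0 ann)
  then show "AnnSeq (\<lambda>i. Der (W i) (W (Suc i))) = W" by (rule ext)
  \<comment> \<open>\<open>W (Suc i)\<close> is generated by \<open>W (Suc (Suc i))\<close> and
    \<open>frob_pow p (Suc i)\<close>. The first is killed by membership in \<open>Der\<close>, the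
    second because it consists of p-th powers from \<open>W i\<close>.\<close>
  have zero: "Der (W (Suc i)) (W (Suc (Suc i))) \<inter> Der (W (Suc i)) (pow_set p (W i)) = {\<lambda>x. 0}" for i
  proof
    have pow: "pow_set p (W i) \<subseteq> W (Suc i)"
      using pow_set_composite_subset[OF sf frob] eq[of i] by simp
    show "{\<lambda>x. 0} \<subseteq> Der (W (Suc i)) (W (Suc (Suc i))) \<inter> Der (W (Suc i)) (pow_set p (W i))"
      using subfield_zero[OF sf] by (auto simp: Der_def)
    show "Der (W (Suc i)) (W (Suc (Suc i))) \<inter> Der (W (Suc i)) (pow_set p (W i)) \<subseteq> {\<lambda>x. 0}"
    proof
      fix D assume D: "D \<in> Der (W (Suc i)) (W (Suc (Suc i))) \<inter> Der (W (Suc i)) (pow_set p (W i))"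
      have "D = (\<lambda>x. 0)"
      proof (rule Der_eq_zeroI[OF sf, where C = "W (Suc (Suc i))" and C' = "frob_pow p (Suc i)"])
        show "D \<in> Der (W (Suc i)) (W (Suc (Suc i)))" using D by blast
        show "W (Suc i) \<subseteq> composite (W (Suc (Suc i))) (frob_pow p (Suc i))" using eq by blast
        have "frob_pow p (Suc i) \<subseteq> pow_set p (W i)"
          using frob[of i] unfolding frob_pow_Suc pow_set_def by blast
        then show "x \<in> W (Suc i) \<and> D x = 0" if "x \<in> W (Suc (Suc i)) \<union> frob_pow p (Suc i)" for x
          using that D sub pow Der_iff[OF sf sub] Der_iff[OF sf pow] by blast
      qed
      then show "D \<in> {\<lambda>x. 0}" by simp
    qed
  qed
  show "jacobson p (\<lambda>i. Der (W i) (W (Suc i)))"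
    unfolding jacobson_def AnnSeq_W using p_Lie_Der[OF sf sub] zero p_Lie_Der[OF sf sub, of 0]
    by (simp add: W0)
qed

text \<open>One level of the descent: once \<open>F\<close> is determined on
  \<open>frob_pow p i\<close>, it is determined on the finitely many p^i-th powers of
  \<open>S\<close>, and \<open>Jacobson_exponent_one\<close> applies.\<close>

lemma jacobson_step:
  assumes A: "subfield (A :: 'a set)" "frob_pow p i \<subseteq> A" and F: "p_Lie p A F"
    and det: "\<forall>D\<in>F. (\<forall>x\<in>frob_pow p i. D x = 0) \<longrightarrow> D = (\<lambda>x. 0)"
  defines "C \<equiv> {a \<in> A. \<forall>D\<in>F. D a = 0}"
  shows "subfield C" "frob_pow p (Suc i) \<subseteq> C" "A = composite C (frob_pow p i)" "Der A C = F"
proof -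
  let ?X = "(\<lambda>s. s ^ (p ^ i)) ` S"
  have X: "finite ?X" "?X \<subseteq> A" using finite_S A(2) power_in_frob_pow by auto
  have F_Der: "D \<in> Der A (pow_set p A)" if "D \<in> F" for D
    using that p_Lie_subset[OF F] by blast
  have pow: "a ^ p \<in> C" if "a \<in> A" for a
    unfolding C_def using subfield_power[OF A(1) that] Der_p_power[OF A(1) F_Der that] by blast
  then show frobC: "frob_pow p (Suc i) \<subseteq> C"
    unfolding frob_pow_Suc pow_set_def using A(2) by blast
  have det_X: "\<forall>D\<in>F. (\<forall>x\<in>?X. D x = 0) \<longrightarrow> D = (\<lambda>x. 0)"
  proof (intro ballI impI)
    fix D assume D: "D \<in> F" "\<forall>x\<in>?X. D x = 0"
    \<comment> \<open>Elements of the perfection are p-th powers of elements of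
      \<open>frob_pow p i\<close>, hence of \<open>A\<close>, so every derivation of
      \<open>A\<close> kills them.\<close>
    have "perfection p \<subseteq> {a \<in> A. D a = 0}"
      using perfection_subset[of "Suc i"] frobC D(1) unfolding C_def by blast
    then have "frob_pow p i \<subseteq> {a \<in> A. D a = 0}"
      using X(2) D(2)
      by (intro frob_pow_subset_if_gen[OF gen_S subfield_kernel[OF A(1) F_Der[OF D(1)]]]) auto
    then show "D = (\<lambda>x. 0)" using det D(1) by blast
  qed
  note J = Jacobson_exponent_one[OF A(1) F X det_X, folded C_def]
  show "subfield C" "Der A C = F" by (fact J)+
  show "A = composite C (frob_pow p i)"
    using finite_generators[OF J(1) frobC] J(2) by simp
qed

lemma power_tower_of_jacobson:
  fixes F :: "nat \<Rightarrow> ('a \<Rightarrow> 'a) set"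
  assumes F: "jacobson p F"
  shows "power_tower p (AnnSeq F)" and "(\<lambda>i. Der (AnnSeq F i) (AnnSeq F (Suc i))) = F"
proof -
  define A where "A = AnnSeq F"
  have A_0: "A 0 = UNIV" and A_Suc: "{x \<in> A i. \<forall>D\<in>F i. D x = 0} = A (Suc i)" for i
    by (simp_all add: A_def)
  have Lie: "p_Lie p (A i) (F i)" for i
    using F by (cases i) (simp_all only: jacobson_def A_def AnnSeq.simps(1))
  have disj: "F (Suc i) \<inter> Der (A (Suc i)) (pow_set p (A i)) = {\<lambda>x. 0}" for i
    using F by (simp only: jacobson_def A_def)
  \<comment> \<open>\<open>A i\<close> is generated by \<open>A (Suc i)\<close> and
    \<open>frob_pow p i\<close>. A derivation killing \<open>frob_pow p (Suc i)\<close> kills the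
    p-th powers of both, hence all of \<open>pow_set p (A i)\<close>, and the trivial intersection
    in the Jacobson condition forces it to be 0.\<close>
  have det_step: "\<forall>D\<in>F (Suc i). (\<forall>x\<in>frob_pow p (Suc i). D x = 0) \<longrightarrow> D = (\<lambda>x. 0)"
    if sf: "subfield (A (Suc i))" and fr: "frob_pow p (Suc i) \<subseteq> A (Suc i)"
      and eq: "A i = composite (A (Suc i)) (frob_pow p i)" for i
  proof (intro ballI impI)
    fix D assume D: "D \<in> F (Suc i)" "\<forall>x\<in>frob_pow p (Suc i). D x = 0"
    have D_Der: "D \<in> Der (A (Suc i)) (pow_set p (A (Suc i)))"
      using D(1) p_Lie_subset[OF Lie] by blast
    have "A i \<subseteq> {x. x ^ (p ^ 1) \<in> {a \<in> A (Suc i). D a = 0}}"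
      unfolding eq
    proof (rule composite_least[OF subfield_frob_vimage[OF subfield_kernel[OF sf D_Der]]])
      show "A (Suc i) \<subseteq> {x. x ^ (p ^ 1) \<in> {a \<in> A (Suc i). D a = 0}}"
        using subfield_power[OF sf] Der_p_power[OF sf D_Der] by auto
      have "x ^ p \<in> frob_pow p (Suc i)" if "x \<in> frob_pow p i" for x :: 'a
        using that by (auto simp: frob_pow_Suc pow_set_def)
      then show "frob_pow p i \<subseteq> {x. x ^ (p ^ 1) \<in> {a \<in> A (Suc i). D a = 0}}"
        using fr D(2) by auto
    qed
    then have "\<forall>x\<in>pow_set p (A i). x \<in> A (Suc i) \<and> D x = 0" by (auto simp: pow_set_def)
    moreover from this have sub: "pow_set p (A i) \<subseteq> A (Suc i)" by blast
    moreover have "D \<in> Der (A (Suc i)) {}" using D_Der Der_antimono[of "{}"] by blast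
    ultimately have "D \<in> Der (A (Suc i)) (pow_set p (A i))" using Der_iff[OF sf sub, of D] by blast
    then show "D = (\<lambda>x. 0)" using disj[of i] D(1) by blast
  qed
  have inv: "subfield (A i) \<and> frob_pow p i \<subseteq> A i \<and>
      (\<forall>D\<in>F i. (\<forall>x\<in>frob_pow p i. D x = 0) \<longrightarrow> D = (\<lambda>x. 0))" for i
  proof (induction i)
    case 0
    \<comment> \<open>At level 0 the determining set \<open>frob_pow p 0\<close> is the whole
      field.\<close>
    show ?case by (simp add: A_0 subfield_UNIV frob_pow_0 fun_eq_iff)
  next
    case (Suc i)
    then have IH: "subfield (A i)" "frob_pow p i \<subseteq> A i"
      "\<forall>D\<in>F i. (\<forall>x\<in>frob_pow p i. D x = 0) \<longrightarrow> D = (\<lambda>x. 0)" by blast+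
    note step = jacobson_step[OF IH(1,2) Lie IH(3), unfolded A_Suc]
    show ?case using step(1,2) det_step[OF step(1,2,3)] by blast
  qed
  have sf: "subfield (A i)" and frob: "frob_pow p i \<subseteq> A i"
    and eq: "A i = composite (A (Suc i)) (frob_pow p i)"
    and Der: "Der (A i) (A (Suc i)) = F i" for i
  proof -
    have I: "subfield (A i)" "frob_pow p i \<subseteq> A i"
      "\<forall>D\<in>F i. (\<forall>x\<in>frob_pow p i. D x = 0) \<longrightarrow> D = (\<lambda>x. 0)" using inv by blast+
    note step = jacobson_step[OF I(1,2) Lie I(3), unfolded A_Suc]
    show "subfield (A i)" "frob_pow p i \<subseteq> A i" by (fact I)+
    show "A i = composite (A (Suc i)) (frob_pow p i)" "Der (A i) (A (Suc i)) = F i" by (fact step)+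
  qed
  \<comment> \<open>The identity between neighbouring levels propagates to all
    \<open>j \<le> i\<close>, since \<open>frob_pow p i\<close> lies in
    \<open>frob_pow p j\<close>.\<close>
  have "A j = composite (A i) (frob_pow p j)" if "j \<le> i" for i j
    using that
  proof (induction i rule: dec_induct)
    case base
    show ?case by (rule composite_absorb[OF sf frob, symmetric])
  next
    case (step i)
    have "A i \<subseteq> composite (A (Suc i)) (frob_pow p j)"
      using eq[of i] composite_mono[OF subset_refl frob_pow_antimono[OF step.hyps(1)]] by blast
    then have "composite (A i) (frob_pow p j) \<subseteq> composite (A (Suc i)) (frob_pow p j)"
      by (intro composite_least subfield_composite composite_upper2)
    moreover have "composite (A (Suc i)) (frob_pow p j) \<subseteq> composite (A i) (frob_pow p j)"
      using A_Suc[of i] by (intro composite_mono) auto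
    ultimately show ?case using step.IH by blast
  qed
  then show "power_tower p (AnnSeq F)"
    unfolding A_def[symmetric] power_tower_def using sf by blast
  show "(\<lambda>i. Der (AnnSeq F i) (AnnSeq F (Suc i))) = F"
    unfolding A_def[symmetric] using Der by (rule ext)
qed

end

text \<open>Each conjunct pairs the well-definedness of one map with the identity for one round
  trip; the four together yield both pairs of mutually inverse bijections.\<close>

theorem mainTheorem3:
  fixes p :: nat
  assumes "prime p" and "of_nat p = (0::'a::field)"
    and "fin_gen_over (perfection p :: 'a set)"
  shows "(\<forall>W::nat \<Rightarrow> 'a set. power_tower p W \<longrightarrow>
            jacobson p (\<lambda>i. Der (W i) (W (Suc i))) \<and>
            AnnSeq (\<lambda>i. Der (W i) (W (Suc i))) = W)
       \<and> (\<forall>F::nat \<Rightarrow> ('a \<Rightarrow> 'a) set. jacobson p F \<longrightarrow>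
            power_tower p (AnnSeq F) \<and>
            (\<lambda>i. Der (AnnSeq F i) (AnnSeq F (Suc i))) = F)
       \<and> (\<forall>W::nat \<Rightarrow> 'a set. power_tower p W \<longrightarrow>
            K_subalg (perfection p) (\<Union>i. Diff (W i)) \<and>
            (\<lambda>n. const ((\<Union>i. Diff (W i)) \<inter> Diff (frob_pow p n))) = W)
       \<and> (\<forall>\<D>::('a \<Rightarrow> 'a) set. K_subalg (perfection p) \<D> \<longrightarrow>
            power_tower p (\<lambda>n. const (\<D> \<inter> Diff (frob_pow p n))) \<and>
            (\<Union>i. Diff (const (\<D> \<inter> Diff (frob_pow p i)))) = \<D>)"
proof -
  obtain S :: "'a set" where S: "finite S" "composite (perfection p) S = UNIV"
    using assms(3) unfolding fin_gen_over_def by blast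
  interpret fin_gen_char_p p "TYPE('a)" S
    by unfold_locales (use assms S in auto)
  show ?thesis
  proof (intro conjI allI impI)
    fix W :: "nat \<Rightarrow> 'a set" assume W: "power_tower p W"
    show "jacobson p (\<lambda>i. Der (W i) (W (Suc i)))" "AnnSeq (\<lambda>i. Der (W i) (W (Suc i))) = W"
      by (rule jacobson_of_power_tower[OF W])+
    show "K_subalg (perfection p) (\<Union>i. Diff (W i))"
      by (rule subalgebra_of_power_tower(1)[OF W])
    show "(\<lambda>n. const ((\<Union>i. Diff (W i)) \<inter> Diff (frob_pow p n))) = W"
      by (rule ext) (rule subalgebra_of_power_tower(2)[OF W])
  next
    fix F :: "nat \<Rightarrow> ('a \<Rightarrow> 'a) set" assume F: "jacobson p F"
    show "power_tower p (AnnSeq F)" "(\<lambda>i. Der (AnnSeq F i) (AnnSeq F (Suc i))) = F"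
      by (rule power_tower_of_jacobson[OF F])+
  next
    fix \<D> :: "('a \<Rightarrow> 'a) set" assume D: "K_subalg (perfection p) \<D>"
    show "power_tower p (\<lambda>n. const (\<D> \<inter> Diff (frob_pow p n)))"
      "(\<Union>i. Diff (const (\<D> \<inter> Diff (frob_pow p i)))) = \<D>"
      by (rule power_tower_of_subalgebra[OF D])+
  qed
qed

end
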